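(* Let $m\ge1$, let $a,b,c_1,\dots,c_m\in\mathbb{C}$, and let $H_A(\beta)$ be the $A$-hypergeometric ideal associated to the matrix $A=A(F_C,m)$ and the parameter vector $\beta=(1-c_1,\dots,1-c_m,\ b-a,\ \sum_{j=1}^m c_j-a-b-m)^T$ (defined in the context), in the variables $u_1,\dots,u_{m+1},u_{-1},\dots,u_{-(m+1)}$. Then the intersection of the singular locus of $H_A(\beta)$ with the complex torus $(\mathbb{C}^* )^{2m+2}$ is equal to the zero set in $(\mathbb{C}^* )^{2m+2}$ of $$\prod_{(\varepsilon_1,\dots,\varepsilon_m)\in\{-1,1\}^m}\left(1+\varepsilon_1\sqrt{\frac{u_1u_{-1}}{u_{m+1}u_{-(m+1)}}}+\cdots+\varepsilon_m\sqrt{\frac{u_mu_{-m}}{u_{m+1}u_{-(m+1)}}}\right).$$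
   Context: Let $e_1,\dots,e_{m+2}$ be the standard basis of $\mathbb{Z}^{m+2}$. The matrix $A=A(F_C,m)$ is the $(m+2)\times(2m+2)$ integer matrix with columns, in order, $e_1+e_{m+2},\dots,e_{m+1}+e_{m+2},-e_1+e_{m+2},\dots,-e_{m+1}+e_{m+2}$. The independent variables corresponding to these columns are $u_1,\dots,u_{m+1},u_{-1},\dots,u_{-(m+1)}$, with associated differential operators $\partial_{1},\dots,\partial_{m+1},\partial_{-1},\dots,\partial_{-(m+1)}$ ($\partial_{\pm j}=\partial/\partial u_{\pm j}$). The toric ideal $I_A$ is the ideal of the commutative polynomial ring $\mathbb{C}[\partial_1,\dots,\partial_{m+1},\partial_{-1},\dots,\partial_{-(m+1)}]$ generated by all $\partial^p-\partial^q$ with $p,q\in\mathbb{N}_0^{2m+2}$ and $Ap=Aq$; it is generated by $\partial_j\partial_{-j}-\partial_{m+1}\partial_{-(m+1)}$, $j=1,\dots,m$. Put $\theta_u=(u_1\partial_1,\dots,u_{m+1}\partial_{m+1},u_{-1}\partial_{-1},\dots,u_{-(m+1)}\partial_{-(m+1)})^T$. The ideal $H_A(\beta)$ is the left ideal of the Weyl algebra in the $2m+2$ variables $u$ generated by $I_A$ and the $m+2$ entries of $A\theta_u-\beta$. For a left ideal $I$ of the Weyl algebra in $n$ variables $x_1,\dots,x_n$, the principal symbol of a nonzero normally ordered operator $p=\sum c_{\alpha\beta}x^\alpha\partial^\beta$ is the sum of the terms $c_{\alpha\beta}x^\alpha\xi^\beta$ with $c_{\alpha\beta}\ne0$ and $|\beta|$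 maximal. The characteristic ideal of $I$ is the ideal of $\mathbb{C}[x,\xi]$ generated by the principal symbols of all nonzero elements of $I$, and the characteristic variety $\mathrm{Ch}(I)\subset\mathbb{C}^{2n}$ is its zero set. The singular locus of $I$ is the image of $\mathrm{Ch}(I)\setminus V(\xi_1,\dots,\xi_n)$ under the projection $(x,\xi)\mapsto x$. The displayed product does not depend on the choice of square roots: it is a polynomial in the ratios $u_ju_{-j}/(u_{m+1}u_{-(m+1)})$. *)

theory Defs
  imports "HOL-Analysis.Analysis" "HOL-Library.Poly_Mapping" "HOL-Library.Product_Plus"
begin

section \<open>Polynomials\<close>

text \<open>
  Throughout, \<open>'v\<close> is a finite type indexing the variables. An exponent vector is a finitely
  supported map into \<open>nat\<close>, and a polynomial is a finitely supported map from exponents to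
  coefficients, with the convolution product of \<^theory>\<open>HOL-Library.Poly_Mapping\<close>.
  In \<open>'v symb\<close> the key \<open>(\<alpha>, \<beta>)\<close> stands for the monomial $x^\alpha \xi^\beta$, so this type is
  the commutative polynomial ring in twice as many variables.
\<close>

type_synonym 'v expo = "'v \<Rightarrow>\<^sub>0 nat"
type_synonym 'v mpoly = "'v expo \<Rightarrow>\<^sub>0 complex"
type_synonym 'v symb = "('v expo \<times> 'v expo) \<Rightarrow>\<^sub>0 complex"

definition mono_eval :: "'v::finite expo \<Rightarrow> complex ^ 'v \<Rightarrow> complex" where
  "mono_eval \<alpha> x = (\<Prod>v\<in>UNIV. (x $ v) ^ Poly_Mapping.lookup \<alpha> v)"

definition symb_eval :: "'v::finite symb \<Rightarrow> complex ^ 'v \<Rightarrow> complex ^ 'v \<Rightarrow> complex" where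
  "symb_eval p x \<xi> =
     (\<Sum>(\<alpha>, \<beta>)\<in>Poly_Mapping.keys p. Poly_Mapping.lookup p (\<alpha>, \<beta>) * mono_eval \<alpha> x * mono_eval \<beta> \<xi>)"

text \<open>The span of a commutative ring as a module over itself is the generated ideal.\<close>

definition ideal_gen :: "'a::comm_ring_1 set \<Rightarrow> 'a set" where
  "ideal_gen S = module.span (*) S"

lemma module_times: "module ((*) :: 'a::comm_ring_1 \<Rightarrow> 'a \<Rightarrow> 'a)"
  by unfold_locales (simp_all add: algebra_simps)

lemma ideal_gen_explicit:
  "ideal_gen S = {(\<Sum>a\<in>t. r a * a) | t r. finite t \<and> t \<subseteq> S}"
  unfolding ideal_gen_def by (rule module.span_explicit[OF module_times])


section \<open>The Weyl algebra\<close>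

text \<open>
  The Weyl algebra is realised as the algebra of differential operators acting on the
  polynomial ring; the product of operators is composition. The representation is faithful
  because the characteristic is zero.
\<close>

type_synonym 'v operator = "'v mpoly \<Rightarrow> 'v mpoly"

definition const_poly :: "complex \<Rightarrow> 'v mpoly" where
  "const_poly c = Poly_Mapping.single 0 c"

definition var_poly :: "'v \<Rightarrow> 'v mpoly" where
  "var_poly v = Poly_Mapping.single (Poly_Mapping.single v 1) 1"

text \<open>
  The subtraction of exponents truncates only when \<open>Poly_Mapping.lookup \<alpha> v = 0\<close>, where the
  coefficient vanishes.
\<close>

definition partial :: "'v \<Rightarrow> 'v operator" where
  "partial v f = (\<Sum>\<alpha>\<in>Poly_Mapping.keys f.
     Poly_Mapping.single (\<alpha> - Poly_Mapping.single v 1) (of_nat (Poly_Mapping.lookup \<alpha> v) * Poly_Mapping.lookup f \<alpha>))"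

inductive_set weyl_algebra :: "'v operator set" where
  const: "(\<lambda>f. const_poly c * f) \<in> weyl_algebra"
| var: "(\<lambda>f. var_poly v * f) \<in> weyl_algebra"
| partial: "partial v \<in> weyl_algebra"
| add: "P \<in> weyl_algebra \<Longrightarrow> Q \<in> weyl_algebra \<Longrightarrow> (\<lambda>f. P f + Q f) \<in> weyl_algebra"
| comp: "P \<in> weyl_algebra \<Longrightarrow> Q \<in> weyl_algebra \<Longrightarrow> P \<circ> Q \<in> weyl_algebra"

inductive_set left_ideal :: "'v operator set \<Rightarrow> 'v operator set"
  for S :: "'v operator set" where
  gen: "P \<in> S \<Longrightarrow> P \<in> left_ideal S"
| zero: "(\<lambda>f. 0) \<in> left_ideal S"
| add: "P \<in> left_ideal S \<Longrightarrow> Q \<in> left_ideal S \<Longrightarrow> (\<lambda>f. P f + Q f) \<in> left_ideal S"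
| mult: "Q \<in> weyl_algebra \<Longrightarrow> P \<in> left_ideal S \<Longrightarrow> Q \<circ> P \<in> left_ideal S"

text \<open>
  \<open>D_pow \<beta>\<close> is $\partial^\beta$: the fold composes the powers of the partial derivatives, in
  an order that is irrelevant because they commute (\<open>comp_fun_commute_partial_pow\<close> below).
\<close>

definition D_pow :: "'v::finite expo \<Rightarrow> 'v operator" where
  "D_pow \<beta> f = Finite_Set.fold (\<lambda>v. partial v ^^ Poly_Mapping.lookup \<beta> v) f UNIV"

lemma lookup_partial:
  "Poly_Mapping.lookup (partial v f) \<alpha> =
     of_nat (Poly_Mapping.lookup \<alpha> v + 1) * Poly_Mapping.lookup f (\<alpha> + Poly_Mapping.single v 1)"
proof -
  let ?e = "Poly_Mapping.single v (1::nat)"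
  have eq: "(of_nat (Poly_Mapping.lookup \<gamma> v) * Poly_Mapping.lookup f \<gamma> when \<gamma> - ?e = \<alpha>) =
        (of_nat (Poly_Mapping.lookup \<alpha> v + 1) * Poly_Mapping.lookup f (\<alpha> + ?e) when \<gamma> = \<alpha> + ?e)" for \<gamma>
  proof (cases "Poly_Mapping.lookup \<gamma> v = 0")
    case True
    then have "\<gamma> \<noteq> \<alpha> + ?e" by (auto simp: lookup_add)
    then show ?thesis using True by simp
  next
    case False
    have "\<gamma> = (\<gamma> - ?e) + ?e"
      using False by (intro poly_mapping_eqI) (auto simp: lookup_add lookup_minus lookup_single when_def)
    then have "\<gamma> - ?e = \<alpha> \<longleftrightarrow> \<gamma> = \<alpha> + ?e"
      by (metis add_diff_cancel_right')
    then show ?thesis by (auto simp: when_def lookup_add)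
  qed
  have "Poly_Mapping.lookup (partial v f) \<alpha> =
      (\<Sum>\<gamma>\<in>Poly_Mapping.keys f. of_nat (Poly_Mapping.lookup \<gamma> v) * Poly_Mapping.lookup f \<gamma> when \<gamma> - ?e = \<alpha>)"
    by (simp add: partial_def lookup_sum lookup_single)
  also have "\<dots> = (\<Sum>\<gamma>\<in>Poly_Mapping.keys f.
      if \<gamma> = \<alpha> + ?e then of_nat (Poly_Mapping.lookup \<alpha> v + 1) * Poly_Mapping.lookup f (\<alpha> + ?e) else 0)"
    by (rule sum.cong) (use eq in \<open>auto simp: when_def\<close>)
  also have "\<dots> = of_nat (Poly_Mapping.lookup \<alpha> v + 1) * Poly_Mapping.lookup f (\<alpha> + ?e)"
    by (simp add: sum.delta in_keys_iff)
  finally show ?thesis .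
qed

lemma partial_commute: "partial v (partial w f) = partial w (partial v f)"
  by (rule poly_mapping_eqI)
     (auto simp: lookup_partial lookup_add lookup_single when_def ac_simps)

lemma comp_fun_commute_partial_pow:
  "comp_fun_commute (\<lambda>v. partial v ^^ Poly_Mapping.lookup \<beta> v)"
proof
  fix v w :: 'a
  have 1: "partial v ((partial w ^^ n) f) = (partial w ^^ n) (partial v f)" for n f
    by (induction n) (simp_all add: partial_commute[of v w])
  have "(partial v ^^ m) ((partial w ^^ n) f) = (partial w ^^ n) ((partial v ^^ m) f)" for m n f
    by (induction m) (simp_all add: 1)
  then show "(partial w ^^ Poly_Mapping.lookup \<beta> w) \<circ> (partial v ^^ Poly_Mapping.lookup \<beta> v) =
             (partial v ^^ Poly_Mapping.lookup \<beta> v) \<circ> (partial w ^^ Poly_Mapping.lookup \<beta> w)"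
    by (simp add: fun_eq_iff)
qed

text \<open>
  The operator $\sum c_{\alpha\beta} x^\alpha \partial^\beta$ with normally ordered expression
  \<open>c\<close>, and the operator $q(\partial)$ of a polynomial \<open>q\<close> in the commuting variables $\partial_v$.
\<close>

definition normal_op :: "'v::finite symb \<Rightarrow> 'v operator" where
  "normal_op c f =
     (\<Sum>(\<alpha>, \<beta>)\<in>Poly_Mapping.keys c. Poly_Mapping.single \<alpha> (Poly_Mapping.lookup c (\<alpha>, \<beta>)) * D_pow \<beta> f)"

definition const_coeff_op :: "'v::finite mpoly \<Rightarrow> 'v operator" where
  "const_coeff_op q f = (\<Sum>\<beta>\<in>Poly_Mapping.keys q. const_poly (Poly_Mapping.lookup q \<beta>) * D_pow \<beta> f)"


section \<open>Characteristic variety and singular locus\<close>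

definition expo_degree :: "'v::finite expo \<Rightarrow> nat" where
  "expo_degree \<beta> = (\<Sum>v\<in>UNIV. Poly_Mapping.lookup \<beta> v)"

definition op_order :: "'v::finite symb \<Rightarrow> nat" where
  "op_order c = Max ((\<lambda>(\<alpha>, \<beta>). expo_degree \<beta>) ` Poly_Mapping.keys c)"

definition principal_symbol :: "'v::finite symb \<Rightarrow> 'v symb" where
  "principal_symbol c =
     (\<Sum>(\<alpha>, \<beta>)\<in>{(\<alpha>, \<beta>) \<in> Poly_Mapping.keys c. expo_degree \<beta> = op_order c}.
        Poly_Mapping.single (\<alpha>, \<beta>) (Poly_Mapping.lookup c (\<alpha>, \<beta>)))"

text \<open>
  Every element of the Weyl algebra is \<open>normal_op c\<close> for exactly one \<open>c\<close>, and it is nonzero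
  iff \<open>c \<noteq> 0\<close>.
\<close>

definition char_ideal :: "'v::finite operator set \<Rightarrow> 'v symb set" where
  "char_ideal I = ideal_gen {principal_symbol c | c. c \<noteq> 0 \<and> normal_op c \<in> I}"

definition char_variety :: "'v::finite operator set \<Rightarrow> ((complex ^ 'v) \<times> (complex ^ 'v)) set" where
  "char_variety I = {(x, \<xi>). \<forall>p\<in>char_ideal I. symb_eval p x \<xi> = 0}"

definition singular_locus :: "'v::finite operator set \<Rightarrow> (complex ^ 'v) set" where
  "singular_locus I = fst ` (char_variety I - {(x, \<xi>). \<xi> = 0})"

definition torus :: "(complex ^ 'v::finite) set" where
  "torus = {u. \<forall>v. u $ v \<noteq> 0}"


section \<open>A-hypergeometric ideals\<close>

definition expo_vec :: "'v::finite expo \<Rightarrow> int ^ 'v" where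
  "expo_vec p = (\<chi> v. int (Poly_Mapping.lookup p v))"

definition toric_ideal :: "int ^ 'v::finite ^ 'r::finite \<Rightarrow> 'v mpoly set" where
  "toric_ideal A = ideal_gen
     {Poly_Mapping.single p 1 - Poly_Mapping.single q 1 | p q. A *v expo_vec p = A *v expo_vec q}"

definition euler_op :: "int ^ 'v::finite ^ 'r::finite \<Rightarrow> complex ^ 'r \<Rightarrow> 'r \<Rightarrow> 'v operator" where
  "euler_op A \<beta> i f =
     (\<Sum>v\<in>UNIV. const_poly (of_int (A $ i $ v)) * (var_poly v * partial v f))
       - const_poly (\<beta> $ i) * f"

definition hypergeometric_ideal ::
    "int ^ 'v::finite ^ 'r::finite \<Rightarrow> complex ^ 'r \<Rightarrow> 'v operator set" where
  "hypergeometric_ideal A \<beta> = left_ideal (const_coeff_op ` toric_ideal A \<union> range (euler_op A \<beta>))"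


section \<open>The matrix of Lauricella's $F_C$\<close>

text \<open>
  The type \<open>'m\<close> plays the role of $\{1,\dots,m\}$, so that $m$ is \<open>CARD('m)\<close>, which is at
  least 1. Indices in $\{1,\dots,m+1\}$ have type \<open>'m option\<close>, where \<open>None\<close> is $m+1$; the
  variables are $u_k$, indexed by \<open>Inl k\<close>, and $u_{-k}$, indexed by \<open>Inr k\<close>. Rows, indexed by
  $\{1,\dots,m+2\}$, have type \<open>'m option option\<close>, where \<open>Some k\<close> is the row $k \le m+1$ and the
  outer \<open>None\<close> is $m+2$.
\<close>

type_synonym 'm fc_var = "'m option + 'm option"
type_synonym 'm fc_row = "'m option option"

definition FC_column :: "'m::finite fc_var \<Rightarrow> int ^ 'm fc_row" where
  "FC_column v = (case v of
     Inl k \<Rightarrow> axis (Some k) 1 + axis None 1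
   | Inr k \<Rightarrow> - axis (Some k) 1 + axis None 1)"

definition FC_matrix :: "int ^ 'm::finite fc_var ^ 'm fc_row" where
  "FC_matrix = (\<chi> i v. FC_column v $ i)"

definition FC_beta :: "complex \<Rightarrow> complex \<Rightarrow> complex ^ 'm::finite \<Rightarrow> complex ^ 'm fc_row" where
  "FC_beta a b c = (\<chi> i. case i of
     Some (Some j) \<Rightarrow> 1 - c $ j
   | Some None \<Rightarrow> b - a
   | None \<Rightarrow> (\<Sum>j\<in>UNIV. c $ j) - a - b - of_nat CARD('m))"

definition FC_ratio :: "complex ^ 'm::finite fc_var \<Rightarrow> 'm \<Rightarrow> complex" where
  "FC_ratio u j =
     (u $ Inl (Some j) * u $ Inr (Some j)) / (u $ Inl None * u $ Inr None)"

end

theory Submission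
  imports Defs
begin

text \<open>
  One inclusion only needs the symbols of the generators. At a point \<open>(u, \<xi>)\<close> of the characteristic
  variety with \<open>u\<close> in the torus and \<open>\<xi> \<noteq> 0\<close>, the Euler operators force $u_k\xi_k = u_{-k}\xi_{-k}$; call this
  number $w_k$. They also force $\sum_k w_k = 0$, and the toric quadrics make
  $\xi_k\xi_{-k}$ independent of $k$, and nonzero as \<open>\<xi> \<noteq> 0\<close>. Hence $w_j^2 / w_{m+1}^2$ is the ratio
  $u_ju_{-j}/(u_{m+1}u_{-(m+1)})$, so that $w_j / w_{m+1}$ is a signed square root of it, and
  $\sum_k w_k = 0$ says that one factor of the product vanishes.
  
  Conversely, a vanishing factor gives such numbers $w_k$, and hence a covector \<open>\<xi>\<close> whose coordinates
  are nonzero, at which the symbols of the generators vanish. The point is that the principal symbol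
  of \<^emph>\<open>every\<close> operator in $H_A(\beta)$ vanishes there. Usually this is read off from a regular
  sequence of symbols; here it follows from one explicit formal solution. Expand a function in the
  divided powers $x^M/M!$, with exponents \<open>M\<close> in all of $\mathbb{C}^n$ and no condition on the
  coefficients \<open>F M\<close>. Then $\partial_v$ shifts \<open>F\<close> and $x_v$ multiplies it by \<open>M $ v\<close> and shifts
  back, so that the Weyl algebra acts on arbitrary functions \<open>F\<close>, and $x^\alpha\partial^{\beta'}$
  becomes a shift by $\beta'-\alpha$ times the product of the falling factorials of length
  $\alpha_v$ of the $M_v$ (\<open>coeff_action\<close>). The indicator function of $\{M \mid AM = \beta\}$ is
  annihilated by $H_A(\beta)$: it is invariant under shifts by $p - q$ with $Ap = Aq$, and the Euler
  operators act as multiplication by the entries of $AM-\beta$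
  (\<open>hypergeometric_ideal_annihilates\<close>).
  
  Thus an operator $\sum c_{\alpha\beta'}x^\alpha\partial^{\beta'}$ in the ideal satisfies, for each
  weight \<open>\<nu>\<close>, the polynomial identity $\sum c_{\alpha\beta'}\prod_v M_v(M_v-1)\cdots(M_v-\alpha_v+1) = 0$
  on the affine space $AM = \beta - \nu$, where the sum extends over the terms with
  $A(\beta'-\alpha) = \nu$. That space is not empty, as \<open>A\<close> has full row rank, and it contains with a
  point \<open>M\<close> the whole line \<open>M + tW\<close> for $W_v = u_v\xi_v$, since \<open>AW = 0\<close>. Homogeneity makes the degree in
  \<open>\<alpha>\<close> and the order in \<open>\<beta>'\<close> differ by a constant, so the top coefficient in \<open>t\<close> is, up to a nonzero
  factor, the weight \<open>\<nu>\<close> part of the principal symbol at \<open>(u, \<xi>)\<close>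
  (\<open>char_variety_hypergeometric\<close>).
\<close>

section \<open>Partial derivatives and their powers\<close>

lemma poly_mapping_sum_induct [case_names zero single add]:
  assumes "P 0" and "\<And>k a. P (Poly_Mapping.single k a)" and "\<And>p q. P p \<Longrightarrow> P q \<Longrightarrow> P (p + q)"
  shows "P p"
proof (induction p rule: update_induct)
  case const
  show ?case by fact
next
  case (update p k a)
  have "Poly_Mapping.update k a p = p + Poly_Mapping.single k a"
    using update.hyps
    by (intro poly_mapping_eqI) (auto simp: lookup_update lookup_add lookup_single in_keys_iff when_def)
  then show ?case using update.IH assms by simp
qed

lemma partial_add: "partial v (f + g) = partial v f + partial v g"
  by (rule poly_mapping_eqI) (simp add: lookup_partial lookup_add algebra_simps)

lemma partial_zero [simp]: "partial v 0 = 0"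
  by (simp add: partial_def)

lemma partial_single:
  "partial v (Poly_Mapping.single \<alpha> a) =
     Poly_Mapping.single (\<alpha> - Poly_Mapping.single v 1) (of_nat (Poly_Mapping.lookup \<alpha> v) * a)"
  by (cases "a = 0") (simp_all add: partial_def)

lemma expo_diff_single_add:
  assumes "Poly_Mapping.lookup \<alpha> v \<noteq> 0"
  shows "\<alpha> - Poly_Mapping.single v (1::nat) + \<kappa> = \<alpha> + \<kappa> - Poly_Mapping.single v 1"
  using assms
  by (intro poly_mapping_eqI) (auto simp: lookup_add lookup_minus lookup_single when_def)

lemma partial_monomial_mult:
  "partial v (Poly_Mapping.single \<alpha> a * g) = Poly_Mapping.single \<alpha> a * partial v g
     + Poly_Mapping.single (\<alpha> - Poly_Mapping.single v 1) (of_nat (Poly_Mapping.lookup \<alpha> v) * a) * g"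
proof (induction g rule: poly_mapping_sum_induct)
  case (single \<kappa> b)
  have L: "partial v (Poly_Mapping.single \<alpha> a * Poly_Mapping.single \<kappa> b) =
      Poly_Mapping.single (\<alpha> + \<kappa> - Poly_Mapping.single v 1) (of_nat (Poly_Mapping.lookup \<kappa> v) * (a * b))
    + Poly_Mapping.single (\<alpha> + \<kappa> - Poly_Mapping.single v 1) (of_nat (Poly_Mapping.lookup \<alpha> v) * (a * b))"
    by (simp add: mult_single partial_single lookup_add single_add[symmetric] algebra_simps)
  have 1: "Poly_Mapping.single (\<alpha> + \<kappa> - Poly_Mapping.single v 1) (of_nat (Poly_Mapping.lookup \<kappa> v) * (a * b))
      = Poly_Mapping.single \<alpha> a * partial v (Poly_Mapping.single \<kappa> b)"
    using expo_diff_single_add[of \<kappa> v \<alpha>]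
    by (cases "Poly_Mapping.lookup \<kappa> v = 0") (simp_all add: partial_single mult_single algebra_simps)
  have 2: "Poly_Mapping.single (\<alpha> + \<kappa> - Poly_Mapping.single v 1) (of_nat (Poly_Mapping.lookup \<alpha> v) * (a * b))
      = Poly_Mapping.single (\<alpha> - Poly_Mapping.single v 1) (of_nat (Poly_Mapping.lookup \<alpha> v) * a)
        * Poly_Mapping.single \<kappa> b"
    using expo_diff_single_add[of \<alpha> v \<kappa>]
    by (cases "Poly_Mapping.lookup \<alpha> v = 0") (simp_all add: mult_single algebra_simps)
  show ?case unfolding L 1 2 ..
qed (simp_all add: partial_add algebra_simps)

lemma lookup_partial_pow:
  "Poly_Mapping.lookup ((partial v ^^ n) f) \<kappa> =
     pochhammer (of_nat (Poly_Mapping.lookup \<kappa> v) + 1) n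
       * Poly_Mapping.lookup f (\<kappa> + Poly_Mapping.single v n)"
proof (induction n arbitrary: \<kappa>)
  case (Suc n)
  have "\<kappa> + Poly_Mapping.single v 1 + Poly_Mapping.single v n = \<kappa> + Poly_Mapping.single v (Suc n)"
    by (simp add: add.assoc single_add[symmetric])
  then show ?case
    by (simp add: lookup_partial Suc.IH lookup_add pochhammer_rec algebra_simps del: One_nat_def)
qed simp

lemma expo_sum_single: "(\<Sum>v\<in>UNIV. Poly_Mapping.single v (Poly_Mapping.lookup \<beta> v)) = (\<beta> :: 'v::finite expo)"
  by (rule poly_mapping_eqI) (simp add: lookup_sum lookup_single when_def)

lemma lookup_D_pow:
  "Poly_Mapping.lookup (D_pow \<beta> f) \<kappa> =
     (\<Prod>v\<in>UNIV. pochhammer (of_nat (Poly_Mapping.lookup \<kappa> v) + 1) (Poly_Mapping.lookup \<beta> v))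
       * Poly_Mapping.lookup f (\<kappa> + \<beta>)"
proof -
  interpret comp_fun_commute "\<lambda>v. partial v ^^ Poly_Mapping.lookup \<beta> v"
    by (rule comp_fun_commute_partial_pow)
  have "Poly_Mapping.lookup (Finite_Set.fold (\<lambda>v. partial v ^^ Poly_Mapping.lookup \<beta> v) f S) \<kappa> =
     (\<Prod>v\<in>S. pochhammer (of_nat (Poly_Mapping.lookup \<kappa> v) + 1) (Poly_Mapping.lookup \<beta> v))
       * Poly_Mapping.lookup f (\<kappa> + (\<Sum>v\<in>S. Poly_Mapping.single v (Poly_Mapping.lookup \<beta> v)))"
    if "finite S" for S
    using that
  proof (induction S arbitrary: \<kappa>)
    case (insert w S)
    have "(\<Prod>v\<in>S. pochhammer (of_nat (Poly_Mapping.lookup (\<kappa> + Poly_Mapping.single w n) v) + 1)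
             (Poly_Mapping.lookup \<beta> v) :: complex) =
          (\<Prod>v\<in>S. pochhammer (of_nat (Poly_Mapping.lookup \<kappa> v) + 1) (Poly_Mapping.lookup \<beta> v))" for n
      using insert.hyps by (intro prod.cong) (auto simp: lookup_add lookup_single when_def)
    then show ?case
      using insert.hyps by (simp add: lookup_partial_pow insert.IH ac_simps)
  qed simp
  from this[of UNIV] show ?thesis
    by (simp add: D_pow_def expo_sum_single)
qed

lemma D_pow_add: "D_pow (\<beta> + \<gamma>) f = D_pow \<beta> (D_pow \<gamma> f)"
proof (rule poly_mapping_eqI)
  fix \<kappa>
  have *: "pochhammer (z + 1) (m + n) = pochhammer (z + 1) m * pochhammer (z + of_nat m + 1) n" for z :: complex and m n
    by (simp add: pochhammer_product' ac_simps)
  show "Poly_Mapping.lookup (D_pow (\<beta> + \<gamma>) f) \<kappa> = Poly_Mapping.lookup (D_pow \<beta> (D_pow \<gamma> f)) \<kappa>"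
    by (simp add: lookup_D_pow lookup_add * prod.distrib add.assoc mult.assoc)
qed

lemma D_pow_zero [simp]: "D_pow 0 f = f"
  by (rule poly_mapping_eqI) (simp add: lookup_D_pow)

lemma D_pow_single: "D_pow (Poly_Mapping.single v n) f = (partial v ^^ n) f"
proof (rule poly_mapping_eqI)
  fix \<kappa>
  have "pochhammer z (n when v = w) = (if w = v then pochhammer z n else 1)" for z :: complex and w
    by (auto simp: when_def)
  then show "Poly_Mapping.lookup (D_pow (Poly_Mapping.single v n) f) \<kappa> =
      Poly_Mapping.lookup ((partial v ^^ n) f) \<kappa>"
    by (simp add: lookup_D_pow lookup_partial_pow lookup_single)
qed

section \<open>Uniqueness of normally ordered expressions\<close>

lemma normal_op_add: "normal_op (c + d) f = normal_op c f + normal_op d f"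
  unfolding normal_op_def case_prod_unfold prod.collapse
  by (rule setsum_keys_plus_distrib) (simp_all add: single_add algebra_simps)

lemma normal_op_zero [simp]: "normal_op 0 f = 0"
  by (simp add: normal_op_def)

lemma normal_op_single:
  "normal_op (Poly_Mapping.single (\<alpha>, \<beta>) a) f = Poly_Mapping.single \<alpha> a * D_pow \<beta> f"
  by (simp add: normal_op_def)

lemma normal_op_uminus: "normal_op (- c) f = - normal_op c f"
  using normal_op_add[of c "- c" f] by (simp add: eq_neg_iff_add_eq_0 add.commute)

text \<open>
  Among the terms of a nonzero expression choose $x^{\alpha_0}\partial^{\beta_0}$ with $\beta_0$ of least
  degree, and apply the operator to $x^{\beta_0}$: every other $\partial^\beta$ that occurs has at least
  the same order and kills $x^{\beta_0}$, so only the coefficients at $\beta_0$ are seen.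
\<close>

lemma normal_op_eq_zero:
  assumes "\<And>f. normal_op c f = 0"
  shows "c = 0"
proof (rule ccontr)
  assume "c \<noteq> 0"
  then have "Poly_Mapping.keys c \<noteq> {}" by simp
  then obtain \<alpha>0 \<beta>0 where key: "(\<alpha>0, \<beta>0) \<in> Poly_Mapping.keys c"
    and min: "\<And>\<alpha> \<beta>. (\<alpha>, \<beta>) \<in> Poly_Mapping.keys c \<Longrightarrow> expo_degree \<beta>0 \<le> expo_degree \<beta>"
    using ex_has_least_nat[of "\<lambda>k. k \<in> Poly_Mapping.keys c" _ "\<lambda>k. expo_degree (snd k)"]
    by (metis all_not_in_conv prod.collapse snd_conv)
  let ?f = "Poly_Mapping.single \<beta>0 (1::complex)"
  let ?N = "\<Prod>v\<in>UNIV. pochhammer 1 (Poly_Mapping.lookup \<beta>0 v) :: complex"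
  have D0: "D_pow \<beta>0 ?f = Poly_Mapping.single 0 ?N"
    by (rule poly_mapping_eqI) (auto simp: lookup_D_pow lookup_single when_def)
  have D: "D_pow \<beta> ?f = 0" if "(\<alpha>, \<beta>) \<in> Poly_Mapping.keys c" "\<beta> \<noteq> \<beta>0" for \<alpha> \<beta>
  proof -
    have "\<kappa> + \<beta> \<noteq> \<beta>0" for \<kappa>
    proof
      assume eq: "\<kappa> + \<beta> = \<beta>0"
      then have "expo_degree \<kappa> + expo_degree \<beta> = expo_degree \<beta>0"
        by (auto simp: expo_degree_def lookup_add sum.distrib)
      with min[OF that(1)] have "expo_degree \<kappa> = 0" by simp
      then have "\<kappa> = 0" by (intro poly_mapping_eqI) (simp add: expo_degree_def)
      with eq that show False by simp
    qed
    then show ?thesis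
      by (intro poly_mapping_eqI) (auto simp: lookup_D_pow lookup_single when_def)
  qed
  have summand: "Poly_Mapping.lookup (case k of (\<alpha>, \<beta>) \<Rightarrow>
        Poly_Mapping.single \<alpha> (Poly_Mapping.lookup c (\<alpha>, \<beta>)) * D_pow \<beta> ?f) \<alpha>0
      = (if k = (\<alpha>0, \<beta>0) then Poly_Mapping.lookup c (\<alpha>0, \<beta>0) * ?N else 0)"
    if "k \<in> Poly_Mapping.keys c" for k
  proof (cases k)
    case (Pair \<alpha> \<beta>)
    then show ?thesis
      using D[of \<alpha> \<beta>] that by (cases "\<beta> = \<beta>0") (auto simp: D0 mult_single lookup_single when_def)
  qed
  have "0 = Poly_Mapping.lookup (normal_op c ?f) \<alpha>0" using assms by simp
  also have "\<dots> = (\<Sum>k\<in>Poly_Mapping.keys c. if k = (\<alpha>0, \<beta>0) then Poly_Mapping.lookup c (\<alpha>0, \<beta>0) * ?N else 0)"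
    unfolding normal_op_def lookup_sum by (rule sum.cong[OF refl summand])
  also have "\<dots> = Poly_Mapping.lookup c (\<alpha>0, \<beta>0) * ?N"
    using key by (simp add: sum.delta)
  finally show False
    using key by (simp add: in_keys_iff pochhammer_fact[symmetric])
qed

lemma normal_op_inject: "normal_op c = normal_op d \<longleftrightarrow> c = d"
proof
  assume "normal_op c = normal_op d"
  then have "normal_op (c - d) f = 0" for f
    using normal_op_add[of c "- d" f] by (simp add: normal_op_uminus)
  then show "c = d" using normal_op_eq_zero[of "c - d"] by simp
qed simp

section \<open>The Weyl algebra acting on coefficients of divided powers\<close>

definition falling :: "complex \<Rightarrow> nat \<Rightarrow> complex" where
  "falling z n = (\<Prod>i<n. z - of_nat i)"

definition falling_expo :: "'v::finite expo \<Rightarrow> complex ^ 'v \<Rightarrow> complex" where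
  "falling_expo \<alpha> M = (\<Prod>v\<in>UNIV. falling (M $ v) (Poly_Mapping.lookup \<alpha> v))"

definition expo_point :: "'v::finite expo \<Rightarrow> complex ^ 'v" where
  "expo_point \<alpha> = (\<chi> v. of_nat (Poly_Mapping.lookup \<alpha> v))"

text \<open>
  If \<open>F M\<close> is the coefficient of the formal divided power $x^M/M!$, then $\partial_v$ replaces \<open>F\<close> by
  $M \mapsto F(M + e_v)$ and $x_v$ replaces it by $M \mapsto M_vF(M - e_v)$. The definition is the
  resulting action of the normally ordered operator with expression \<open>c\<close>. The exponents \<open>M\<close> are
  arbitrary complex vectors; the action makes sense for every \<open>F\<close>, because each coefficient of the
  result depends on finitely many values of \<open>F\<close>.
\<close>

definition coeff_action :: "'v::finite symb \<Rightarrow> (complex ^ 'v \<Rightarrow> complex) \<Rightarrow> complex ^ 'v \<Rightarrow> complex" where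
  "coeff_action c F M = (\<Sum>(\<alpha>, \<beta>)\<in>Poly_Mapping.keys c.
     Poly_Mapping.lookup c (\<alpha>, \<beta>) * falling_expo \<alpha> M * F (M - expo_point \<alpha> + expo_point \<beta>))"

lemma expo_point_add: "expo_point (\<alpha> + \<beta>) = expo_point \<alpha> + expo_point \<beta>"
  by (simp add: expo_point_def vec_eq_iff lookup_add)

lemma expo_point_single: "expo_point (Poly_Mapping.single v n) = axis v (of_nat n)"
  by (auto simp: expo_point_def vec_eq_iff axis_def lookup_single when_def)

lemma expo_point_zero [simp]: "expo_point 0 = 0"
  by (simp add: expo_point_def vec_eq_iff)

lemma falling_zero [simp]: "falling z 0 = 1"
  by (simp add: falling_def)

lemma falling_expo_zero [simp]: "falling_expo 0 M = 1"
  by (simp add: falling_expo_def)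

lemma falling_Suc: "falling z (Suc n) = (z - of_nat n) * falling z n"
  by (simp add: falling_def)

lemma falling_Suc_shift: "falling z (Suc n) = z * falling (z - 1) n"
  unfolding falling_def prod.lessThan_Suc_shift by (simp add: diff_diff_eq)

lemma falling_expo_add_single:
  "falling_expo (\<alpha> + Poly_Mapping.single v 1) M
     = (M $ v - of_nat (Poly_Mapping.lookup \<alpha> v)) * falling_expo \<alpha> M"
proof -
  have "falling (M $ w) (Poly_Mapping.lookup (\<alpha> + Poly_Mapping.single v 1) w) =
      (if w = v then M $ v - of_nat (Poly_Mapping.lookup \<alpha> v) else 1)
        * falling (M $ w) (Poly_Mapping.lookup \<alpha> w)" for w
    by (auto simp: lookup_add lookup_single when_def falling_Suc)
  then show ?thesis
    by (simp add: falling_expo_def prod.distrib del: One_nat_def)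
qed

lemma falling_expo_add_single_shift:
  "falling_expo (\<alpha> + Poly_Mapping.single v 1) M = M $ v * falling_expo \<alpha> (M - axis v 1)"
proof -
  have "falling (M $ w) (Poly_Mapping.lookup (\<alpha> + Poly_Mapping.single v 1) w) =
      (if w = v then M $ v else 1) * falling ((M - axis v 1) $ w) (Poly_Mapping.lookup \<alpha> w)" for w
    by (auto simp: lookup_add lookup_single when_def falling_Suc_shift axis_def)
  then show ?thesis
    by (simp add: falling_expo_def prod.distrib del: One_nat_def vector_minus_component)
qed

lemma expo_obtain_Suc:
  assumes "Poly_Mapping.lookup \<alpha> v \<noteq> (0::nat)"
  obtains \<gamma> where "\<alpha> = \<gamma> + Poly_Mapping.single v 1"
proof
  show "\<alpha> = (\<alpha> - Poly_Mapping.single v 1) + Poly_Mapping.single v 1"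
    using assms
    by (intro poly_mapping_eqI) (auto simp: lookup_add lookup_minus lookup_single when_def)
qed

text \<open>
  This is the relation $[\partial_v, x^\alpha] = \alpha_v x^{\alpha-e_v}$, read on coefficients.
\<close>

lemma falling_expo_shift:
  "falling_expo \<alpha> (M + axis v 1) = falling_expo \<alpha> M
     + of_nat (Poly_Mapping.lookup \<alpha> v) * falling_expo (\<alpha> - Poly_Mapping.single v 1) M"
proof (cases "Poly_Mapping.lookup \<alpha> v = 0")
  case True
  have "falling ((M + axis v 1) $ w) (Poly_Mapping.lookup \<alpha> w) = falling (M $ w) (Poly_Mapping.lookup \<alpha> w)" for w
    using True by (cases "w = v") (auto simp: axis_def)
  with True show ?thesis by (simp add: falling_expo_def del: vector_add_component)
next
  case False
  then obtain \<gamma> where \<alpha>: "\<alpha> = \<gamma> + Poly_Mapping.single v 1" by (rule expo_obtain_Suc)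
  have "falling_expo \<alpha> (M + axis v 1) = (M $ v + 1) * falling_expo \<gamma> M"
    unfolding \<alpha> falling_expo_add_single_shift by simp
  moreover have "falling_expo \<alpha> M = (M $ v - of_nat (Poly_Mapping.lookup \<gamma> v)) * falling_expo \<gamma> M"
    unfolding \<alpha> falling_expo_add_single by simp
  moreover have "\<alpha> - Poly_Mapping.single v 1 = \<gamma>" "Poly_Mapping.lookup \<alpha> v = Poly_Mapping.lookup \<gamma> v + 1"
    unfolding \<alpha> by (simp_all add: lookup_add)
  ultimately show ?thesis by (simp add: algebra_simps)
qed

lemma coeff_action_add: "coeff_action (c + d) F M = coeff_action c F M + coeff_action d F M"
  unfolding coeff_action_def case_prod_unfold prod.collapse
  by (rule setsum_keys_plus_distrib) (simp_all add: algebra_simps)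

lemma coeff_action_zero [simp]: "coeff_action 0 F M = 0"
  by (simp add: coeff_action_def)

lemma coeff_action_single:
  "coeff_action (Poly_Mapping.single (\<alpha>, \<beta>) a) F M
     = a * falling_expo \<alpha> M * F (M - expo_point \<alpha> + expo_point \<beta>)"
  by (simp add: coeff_action_def)

text \<open>
  Operators, rather than their expressions, that kill \<open>F\<close>. Uniqueness of normally ordered
  expressions makes membership independent of the chosen expression.
\<close>

definition annihilators :: "(complex ^ 'v::finite \<Rightarrow> complex) \<Rightarrow> 'v operator set" where
  "annihilators F = {normal_op c | c. \<forall>M. coeff_action c F M = 0}"

lemma normal_op_annihilates:
  "normal_op c \<in> annihilators F \<longleftrightarrow> (\<forall>M. coeff_action c F M = 0)"
  by (auto simp: annihilators_def normal_op_inject)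

text \<open>
  To act by an additive operator \<open>Q\<close> after an annihilating operator, it suffices to know on single
  terms that \<open>Q\<close> yields again a normally ordered operator, whose action is that of the term
  evaluated at a moved point and scaled. Both properties are additive in the expression.
\<close>

lemma annihilators_compI:
  assumes P: "P \<in> annihilators F"
    and zero: "Q 0 = 0" and add: "\<And>f g. Q (f + g) = Q f + Q g"
    and monomial: "\<And>\<alpha> \<beta> a. \<exists>d. (\<forall>f. normal_op d f = Q (Poly_Mapping.single \<alpha> a * D_pow \<beta> f))
      \<and> (\<forall>M. coeff_action d F M = g M * coeff_action (Poly_Mapping.single (\<alpha>, \<beta>) a) F (s M))"
  shows "Q \<circ> P \<in> annihilators F"
proof -
  have ex: "\<exists>d. (\<forall>f. normal_op d f = Q (normal_op c f))
      \<and> (\<forall>M. coeff_action d F M = g M * coeff_action c F (s M))" for c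
  proof (induction c rule: poly_mapping_sum_induct)
    case zero
    show ?case by (rule exI[of _ 0]) (simp add: \<open>Q 0 = 0\<close>)
  next
    case (single k a)
    show ?case using monomial[of "fst k" a "snd k"] by (simp add: normal_op_single[symmetric])
  next
    case (add p q)
    then obtain p' q' where "\<forall>f. normal_op p' f = Q (normal_op p f)"
        "\<forall>M. coeff_action p' F M = g M * coeff_action p F (s M)"
        "\<forall>f. normal_op q' f = Q (normal_op q f)"
        "\<forall>M. coeff_action q' F M = g M * coeff_action q F (s M)" by blast
    then show ?case
      by (intro exI[of _ "p' + q'"])
        (simp add: normal_op_add coeff_action_add assms(3) algebra_simps)
  qed
  obtain c where c: "P = normal_op c" "\<forall>M. coeff_action c F M = 0"
    using P by (auto simp: annihilators_def)
  obtain d where "\<forall>f. normal_op d f = Q (normal_op c f)"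
      "\<forall>M. coeff_action d F M = g M * coeff_action c F (s M)"
    using ex by blast
  with c have "Q \<circ> P = normal_op d" "\<forall>M. coeff_action d F M = 0"
    by (simp_all add: fun_eq_iff)
  then show ?thesis by (auto simp: annihilators_def)
qed

lemma annihilators_const:
  assumes "P \<in> annihilators F"
  shows "(\<lambda>f. const_poly z * f) \<circ> P \<in> annihilators F"
proof (rule annihilators_compI[OF assms, where g = "\<lambda>_. z" and s = "\<lambda>M. M"])
  fix \<alpha> \<beta> :: "'a expo" and a :: complex
  show "\<exists>d. (\<forall>f. normal_op d f = const_poly z * (Poly_Mapping.single \<alpha> a * D_pow \<beta> f))
      \<and> (\<forall>M. coeff_action d F M = z * coeff_action (Poly_Mapping.single (\<alpha>, \<beta>) a) F M)"
    by (rule exI[of _ "Poly_Mapping.single (\<alpha>, \<beta>) (z * a)"])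
      (simp add: normal_op_single coeff_action_single const_poly_def mult_single mult.assoc[symmetric])
qed (simp_all add: algebra_simps)

lemma annihilators_var:
  assumes "P \<in> annihilators F"
  shows "(\<lambda>f. var_poly v * f) \<circ> P \<in> annihilators F"
proof (rule annihilators_compI[OF assms, where g = "\<lambda>M. M $ v" and s = "\<lambda>M. M - axis v 1"])
  fix \<alpha> \<beta> :: "'a expo" and a :: complex
  let ?d = "Poly_Mapping.single (\<alpha> + Poly_Mapping.single v 1, \<beta>) a"
  have "normal_op ?d f = var_poly v * (Poly_Mapping.single \<alpha> a * D_pow \<beta> f)" for f
    by (simp add: normal_op_single var_poly_def mult_single mult.assoc[symmetric] add.commute)
  moreover have "coeff_action ?d F M
      = M $ v * coeff_action (Poly_Mapping.single (\<alpha>, \<beta>) a) F (M - axis v 1)" for M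
    by (simp add: coeff_action_single falling_expo_add_single_shift expo_point_add expo_point_single
        diff_diff_eq add.commute del: One_nat_def)
  ultimately show "\<exists>d. (\<forall>f. normal_op d f = var_poly v * (Poly_Mapping.single \<alpha> a * D_pow \<beta> f))
      \<and> (\<forall>M. coeff_action d F M
           = M $ v * coeff_action (Poly_Mapping.single (\<alpha>, \<beta>) a) F (M - axis v 1))" by blast
qed (simp_all add: algebra_simps)

lemma annihilators_partial:
  assumes "P \<in> annihilators F"
  shows "partial v \<circ> P \<in> annihilators F"
proof (rule annihilators_compI[OF assms, where g = "\<lambda>_. 1" and s = "\<lambda>M. M + axis v 1"])
  fix \<alpha> \<beta> :: "'a expo" and a :: complex
  let ?e = "Poly_Mapping.single v (1::nat)"
  let ?d = "Poly_Mapping.single (\<alpha>, ?e + \<beta>) a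
    + Poly_Mapping.single (\<alpha> - ?e, \<beta>) (of_nat (Poly_Mapping.lookup \<alpha> v) * a)"
  have "normal_op ?d f = partial v (Poly_Mapping.single \<alpha> a * D_pow \<beta> f)" for f
    by (simp add: normal_op_add normal_op_single partial_monomial_mult D_pow_add D_pow_single)
  moreover have "coeff_action ?d F M
      = 1 * coeff_action (Poly_Mapping.single (\<alpha>, \<beta>) a) F (M + axis v 1)" for M
  proof -
    have shift: "M - expo_point \<alpha> + expo_point (?e + \<beta>) = M + axis v 1 - expo_point \<alpha> + expo_point \<beta>"
      by (simp add: expo_point_add expo_point_single del: One_nat_def)
    have "of_nat (Poly_Mapping.lookup \<alpha> v) * F (M - expo_point (\<alpha> - ?e) + expo_point \<beta>)
        = of_nat (Poly_Mapping.lookup \<alpha> v) * F (M + axis v 1 - expo_point \<alpha> + expo_point \<beta>)"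
    proof (cases "Poly_Mapping.lookup \<alpha> v = 0")
      case False
      then obtain \<gamma> where "\<alpha> = \<gamma> + ?e" by (rule expo_obtain_Suc)
      then show ?thesis
        by (simp add: expo_point_add expo_point_single algebra_simps del: One_nat_def)
    qed simp
    then show ?thesis
      unfolding coeff_action_add coeff_action_single falling_expo_shift shift
      by (auto simp: algebra_simps)
  qed
  ultimately show "\<exists>d. (\<forall>f. normal_op d f = partial v (Poly_Mapping.single \<alpha> a * D_pow \<beta> f))
      \<and> (\<forall>M. coeff_action d F M
           = 1 * coeff_action (Poly_Mapping.single (\<alpha>, \<beta>) a) F (M + axis v 1))" by blast
qed (simp_all add: partial_add)

lemma annihilators_add:
  assumes "P \<in> annihilators F" "Q \<in> annihilators F"
  shows "(\<lambda>f. P f + Q f) \<in> annihilators F"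
proof -
  obtain c d where "P = normal_op c" "Q = normal_op d"
    "\<forall>M. coeff_action c F M = 0" "\<forall>M. coeff_action d F M = 0"
    using assms by (auto simp: annihilators_def)
  then have "(\<lambda>f. P f + Q f) = normal_op (c + d)" "\<forall>M. coeff_action (c + d) F M = 0"
    by (simp_all add: fun_eq_iff normal_op_add coeff_action_add)
  then show ?thesis by (auto simp: annihilators_def)
qed

lemma annihilators_weyl:
  assumes "Q \<in> weyl_algebra" "P \<in> annihilators F"
  shows "Q \<circ> P \<in> annihilators F"
  using assms
proof (induction Q arbitrary: P)
  case (add Q R)
  then show ?case using annihilators_add[of "Q \<circ> P" F "R \<circ> P"] by (simp add: comp_def)
next
  case (comp Q R)
  then show ?case by (simp add: comp_assoc)
qed (use annihilators_const annihilators_var annihilators_partial in auto)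

lemma left_ideal_subset_annihilators:
  assumes "S \<subseteq> annihilators F"
  shows "left_ideal S \<subseteq> annihilators F"
proof
  fix P assume "P \<in> left_ideal S"
  then show "P \<in> annihilators F"
  proof induction
    case zero
    have "normal_op 0 = (\<lambda>f::'a mpoly. 0)" by (simp add: fun_eq_iff)
    then show ?case by (auto simp: annihilators_def intro!: exI[of _ 0])
  next
    case (mult Q P)
    then show ?case by (intro annihilators_weyl)
  qed (use assms annihilators_add in auto)
qed


lemma normal_op_sum: "normal_op (\<Sum>x\<in>X. g x) f = (\<Sum>x\<in>X. normal_op (g x) f)"
  by (induction X rule: infinite_finite_induct) (simp_all add: normal_op_add)

lemma coeff_action_sum: "coeff_action (\<Sum>x\<in>X. g x) F M = (\<Sum>x\<in>X. coeff_action (g x) F M)"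
  by (induction X rule: infinite_finite_induct) (simp_all add: coeff_action_add)

section \<open>A formal solution of the hypergeometric system\<close>

definition weight :: "int ^ 'v::finite ^ 'r \<Rightarrow> complex ^ 'v \<Rightarrow> complex ^ 'r" where
  "weight A M = (\<chi> i. \<Sum>v\<in>UNIV. of_int (A $ i $ v) * M $ v)"

lemma weight_add: "weight A (M + N) = weight A M + weight A N"
  by (simp add: weight_def vec_eq_iff sum.distrib algebra_simps)

lemma weight_diff: "weight A (M - N) = weight A M - weight A N"
  by (simp add: weight_def vec_eq_iff sum_subtractf algebra_simps)

lemma weight_scale: "weight A (z *s M) = z *s weight A M"
  by (simp add: weight_def vec_eq_iff sum_distrib_left mult.left_commute)

lemma weight_expo_point_eq_iff:
  "weight A (expo_point p) = weight A (expo_point q) \<longleftrightarrow> A *v expo_vec p = A *v expo_vec q"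
proof -
  have "weight A (expo_point r) $ i = of_int ((A *v expo_vec r) $ i)" for r i
    by (simp add: weight_def expo_point_def expo_vec_def matrix_vector_mult_def)
  then show ?thesis by (simp add: vec_eq_iff)
qed

text \<open>
  These are the coefficients of $\sum_{AM=\beta} x^M/M!$, a formal solution that collects the
  exponents of all $\Gamma$-series of the system at once.
\<close>

definition weight_indicator :: "int ^ 'v::finite ^ 'r \<Rightarrow> complex ^ 'r \<Rightarrow> complex ^ 'v \<Rightarrow> complex" where
  "weight_indicator A \<beta> M = of_bool (weight A M = \<beta>)"

definition const_coeff_symb :: "'v::finite mpoly \<Rightarrow> 'v symb" where
  "const_coeff_symb q = (\<Sum>\<beta>\<in>Poly_Mapping.keys q. Poly_Mapping.single (0, \<beta>) (Poly_Mapping.lookup q \<beta>))"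

lemma normal_op_const_coeff_symb: "normal_op (const_coeff_symb q) = const_coeff_op q"
  by (simp add: fun_eq_iff const_coeff_symb_def const_coeff_op_def normal_op_sum normal_op_single const_poly_def)

definition euler_symb :: "int ^ 'v::finite ^ 'r::finite \<Rightarrow> complex ^ 'r \<Rightarrow> 'r \<Rightarrow> 'v symb" where
  "euler_symb A \<beta> i = (\<Sum>v\<in>UNIV. Poly_Mapping.single (Poly_Mapping.single v 1, Poly_Mapping.single v 1)
       (of_int (A $ i $ v))) + Poly_Mapping.single (0, 0) (- \<beta> $ i)"

lemma normal_op_euler_symb: "normal_op (euler_symb A \<beta> i) = euler_op A \<beta> i"
proof
  fix f
  have 1: "Poly_Mapping.single (Poly_Mapping.single v 1) z * g = const_poly z * (var_poly v * g)"
    for z v and g :: "'a mpoly"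
    by (simp add: const_poly_def var_poly_def mult.assoc[symmetric] mult_single
        del: One_nat_def single_of_int)
  have 2: "Poly_Mapping.single 0 (- z) * g = - (const_poly z * g)" for z and g :: "'a mpoly"
    by (simp add: const_poly_def single_uminus)
  show "normal_op (euler_symb A \<beta> i) f = euler_op A \<beta> i f"
    unfolding euler_symb_def euler_op_def normal_op_add normal_op_sum normal_op_single 1
    by (simp add: 2 D_pow_single)
qed

text \<open>
  On divided powers $x_v\partial_v$ is multiplication by $M_v$, so the Euler operator multiplies the
  coefficient at \<open>M\<close> by the corresponding entry of $AM - \beta$.
\<close>

lemma euler_op_annihilates: "euler_op A \<beta> i \<in> annihilators (weight_indicator A \<beta>)"
proof -
  have f1: "falling_expo (Poly_Mapping.single v 1) M = M $ v" for v :: 'a and M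
    using falling_expo_add_single[of 0 v M] by simp
  have "coeff_action (euler_symb A \<beta> i) (weight_indicator A \<beta>) M
      = (weight A M $ i - \<beta> $ i) * weight_indicator A \<beta> M" for M
    by (simp add: euler_symb_def coeff_action_add coeff_action_sum coeff_action_single f1 weight_def
        sum_distrib_right left_diff_distrib del: One_nat_def)
  then have "coeff_action (euler_symb A \<beta> i) (weight_indicator A \<beta>) M = 0" for M
    by (auto simp: weight_indicator_def)
  then show ?thesis
    by (simp add: normal_op_euler_symb[symmetric] normal_op_annihilates)
qed

text \<open>
  The action of a constant coefficient operator, indexed by polynomials so that the product in the
  ring of polynomials in the $\partial_v$ can be used.
\<close>

definition const_action :: "'v::finite mpoly \<Rightarrow> (complex ^ 'v \<Rightarrow> complex) \<Rightarrow> complex ^ 'v \<Rightarrow> complex" where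
  "const_action q F M = (\<Sum>\<beta>\<in>Poly_Mapping.keys q. Poly_Mapping.lookup q \<beta> * F (M + expo_point \<beta>))"

lemma const_action_add: "const_action (p + q) F M = const_action p F M + const_action q F M"
  unfolding const_action_def by (rule setsum_keys_plus_distrib) (simp_all add: algebra_simps)

lemma const_action_zero [simp]: "const_action 0 F M = 0"
  by (simp add: const_action_def)

lemma const_action_single:
  "const_action (Poly_Mapping.single \<beta> a) F M = a * F (M + expo_point \<beta>)"
  by (simp add: const_action_def)

lemma const_action_binomial_multiple:
  assumes "\<And>M. F (M + expo_point p) = F (M + expo_point q)"
  shows "const_action (r * (Poly_Mapping.single p 1 - Poly_Mapping.single q 1)) F M = 0"
proof (induction r rule: poly_mapping_sum_induct)
  case (single k a)
  have "Poly_Mapping.single k a * (Poly_Mapping.single p 1 - Poly_Mapping.single q 1)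
      = Poly_Mapping.single (k + p) a + Poly_Mapping.single (k + q) (- a)"
    by (simp add: right_diff_distrib mult_single single_uminus)
  then show ?case
    using assms[of "M + expo_point k"]
    by (simp add: const_action_add const_action_single expo_point_add add.assoc)
qed (simp_all add: distrib_right const_action_add)

lemma toric_op_annihilates:
  assumes "q \<in> toric_ideal A"
  shows "const_coeff_op q \<in> annihilators (weight_indicator A \<beta>)"
proof -
  have "const_action q (weight_indicator A \<beta>) M = 0" for M
    using assms unfolding toric_ideal_def ideal_gen_def
  proof (induction rule: module.span_induct_alt[OF module_times, consumes 1, case_names base step])
    case (step r x y)
    then obtain p q where x: "x = Poly_Mapping.single p 1 - Poly_Mapping.single q 1"
      and pq: "A *v expo_vec p = A *v expo_vec q" by auto
    have "weight_indicator A \<beta> (N + expo_point p) = weight_indicator A \<beta> (N + expo_point q)" for N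
      using pq by (simp add: weight_indicator_def weight_add weight_expo_point_eq_iff[symmetric])
    from const_action_binomial_multiple[OF this] step show ?case
      by (simp add: const_action_add x)
  qed simp
  then have "coeff_action (const_coeff_symb q) (weight_indicator A \<beta>) M = 0" for M
    by (simp add: const_coeff_symb_def coeff_action_sum coeff_action_single const_action_def)
  then show ?thesis
    by (simp add: normal_op_const_coeff_symb[symmetric] normal_op_annihilates)
qed

lemma hypergeometric_ideal_annihilates:
  assumes "normal_op c \<in> hypergeometric_ideal A \<beta>"
  shows "coeff_action c (weight_indicator A \<beta>) M = 0"
proof -
  have "hypergeometric_ideal A \<beta> \<subseteq> annihilators (weight_indicator A \<beta>)"
    unfolding hypergeometric_ideal_def
    by (rule left_ideal_subset_annihilators) (auto simp: toric_op_annihilates euler_op_annihilates)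
  with assms show ?thesis by (auto simp: normal_op_annihilates)
qed

section \<open>Points of the characteristic variety\<close>

lemma mono_eval_add: "mono_eval (\<alpha> + \<beta>) x = mono_eval \<alpha> x * mono_eval \<beta> x"
  by (simp add: mono_eval_def lookup_add power_add prod.distrib)

lemma mono_eval_zero [simp]: "mono_eval 0 x = 1"
  by (simp add: mono_eval_def)

lemma mono_eval_single: "mono_eval (Poly_Mapping.single v n) x = (x $ v) ^ n"
proof -
  have "(x $ w) ^ (n when v = w) = (if w = v then (x $ v) ^ n else 1)" for w
    by (auto simp: when_def)
  then show ?thesis by (simp add: mono_eval_def lookup_single)
qed

lemma symb_eval_add: "symb_eval (p + q) x \<xi> = symb_eval p x \<xi> + symb_eval q x \<xi>"
  unfolding symb_eval_def case_prod_unfold prod.collapse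
  by (rule setsum_keys_plus_distrib) (simp_all add: algebra_simps)

lemma symb_eval_zero [simp]: "symb_eval 0 x \<xi> = 0"
  by (simp add: symb_eval_def)

lemma symb_eval_single:
  "symb_eval (Poly_Mapping.single k a) x \<xi> = a * mono_eval (fst k) x * mono_eval (snd k) \<xi>"
  by (simp add: symb_eval_def case_prod_unfold)

lemma symb_eval_sum: "symb_eval (\<Sum>i\<in>I. g i) x \<xi> = (\<Sum>i\<in>I. symb_eval (g i) x \<xi>)"
  by (induction I rule: infinite_finite_induct) (simp_all add: symb_eval_add)

lemma symb_eval_mult: "symb_eval (p * q) x \<xi> = symb_eval p x \<xi> * symb_eval q x \<xi>"
proof (induction p rule: poly_mapping_sum_induct)
  case (single k a)
  show ?case
  proof (induction q rule: poly_mapping_sum_induct)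
    case (single l b)
    show ?case
      by (simp add: mult_single symb_eval_single mono_eval_add)
  qed (simp_all add: distrib_left symb_eval_add)
qed (simp_all add: distrib_right symb_eval_add)

text \<open>
  Evaluation at a point is a ring homomorphism, hence vanishing need only be tested on the principal
  symbols and not on the whole ideal that they generate.
\<close>

lemma char_variety_iff:
  "(x, \<xi>) \<in> char_variety I \<longleftrightarrow>
     (\<forall>c. c \<noteq> 0 \<longrightarrow> normal_op c \<in> I \<longrightarrow> symb_eval (principal_symbol c) x \<xi> = 0)"
proof
  assume "(x, \<xi>) \<in> char_variety I"
  then show "\<forall>c. c \<noteq> 0 \<longrightarrow> normal_op c \<in> I \<longrightarrow> symb_eval (principal_symbol c) x \<xi> = 0"
    by (auto simp: char_variety_def char_ideal_def ideal_gen_def intro!: module.span_base[OF module_times])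
next
  assume *: "\<forall>c. c \<noteq> 0 \<longrightarrow> normal_op c \<in> I \<longrightarrow> symb_eval (principal_symbol c) x \<xi> = 0"
  have "symb_eval p x \<xi> = 0" if "p \<in> char_ideal I" for p
    using that unfolding char_ideal_def ideal_gen_def
    by (induction rule: module.span_induct_alt[OF module_times, consumes 1, case_names base step])
      (use * in \<open>auto simp: symb_eval_add symb_eval_mult\<close>)
  then show "(x, \<xi>) \<in> char_variety I" by (simp add: char_variety_def)
qed

lemma symb_eval_principal_symbol:
  "symb_eval (principal_symbol c) x \<xi> =
     (\<Sum>k\<in>{k \<in> Poly_Mapping.keys c. expo_degree (snd k) = op_order c}.
        Poly_Mapping.lookup c k * mono_eval (fst k) x * mono_eval (snd k) \<xi>)"
proof -
  have "{(\<alpha>, \<beta>) \<in> Poly_Mapping.keys c. expo_degree \<beta> = op_order c}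
      = {k \<in> Poly_Mapping.keys c. expo_degree (snd k) = op_order c}" by auto
  then show ?thesis
    by (simp add: principal_symbol_def symb_eval_sum case_prod_unfold symb_eval_single)
qed

lemma prod_linear_poly:
  fixes a b :: "'i \<Rightarrow> 'a::comm_ring_1"
  assumes "finite I"
  shows "degree (\<Prod>i\<in>I. [:a i, b i:]) \<le> card I
    \<and> coeff (\<Prod>i\<in>I. [:a i, b i:]) (card I) = (\<Prod>i\<in>I. b i)"
  using assms
proof (induction I)
  case (insert j I)
  let ?p = "\<Prod>i\<in>I. [:a i, b i:]"
  have "degree ([:a j, b j:] * ?p) \<le> 1 + card I"
    using degree_mult_le[of "[:a j, b j:]" ?p] insert.IH
    by (simp del: mult_pCons_left split: if_splits)
  moreover have "coeff ?p (Suc (card I)) = 0"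
    using insert.IH by (simp add: coeff_eq_0)
  ultimately show ?case
    using insert by (simp add: mult_pCons_left)
qed simp

text \<open>
  Restricted to a line, a product of falling factorials is a polynomial whose top coefficient is the
  monomial at the direction of the line. Falling factorials thus see the leading behaviour
  in \<open>\<alpha>\<close> only, which is what relates the action on coefficients to principal symbols.
\<close>

lemma falling_expo_line_poly:
  fixes M W :: "complex ^ 'v::finite" and \<alpha> :: "'v expo"
  obtains p where "\<And>t. poly p t = falling_expo \<alpha> (M + t *s W)"
    and "degree p \<le> expo_degree \<alpha>" and "coeff p (expo_degree \<alpha>) = mono_eval \<alpha> W"
proof
  let ?I = "SIGMA v:UNIV. {..<Poly_Mapping.lookup \<alpha> v}"
  let ?p = "\<Prod>i\<in>?I. [:M $ fst i - of_nat (snd i), W $ fst i:]"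
  have card: "card ?I = expo_degree \<alpha>"
    by (simp add: expo_degree_def)
  have fin: "finite ?I" by simp
  note top = prod_linear_poly[OF fin, of "\<lambda>i. M $ fst i - of_nat (snd i)" "\<lambda>i. W $ fst i"]
  show "degree ?p \<le> expo_degree \<alpha>"
    using top by (simp only: card)
  have "(\<Prod>i\<in>?I. W $ fst i) = (\<Prod>v\<in>UNIV. \<Prod>j<Poly_Mapping.lookup \<alpha> v. W $ v)"
    by (subst prod.Sigma) (simp_all add: case_prod_unfold)
  with top show "coeff ?p (expo_degree \<alpha>) = mono_eval \<alpha> W"
    by (simp only: card) (simp add: mono_eval_def)
  show "poly ?p t = falling_expo \<alpha> (M + t *s W)" for t
  proof -
    have "poly ?p t = (\<Prod>(v, j)\<in>?I. (M + t *s W) $ v - of_nat j)"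
      unfolding poly_prod by (intro prod.cong) (auto simp: algebra_simps)
    also have "\<dots> = falling_expo \<alpha> (M + t *s W)"
      unfolding falling_expo_def falling_def by (subst prod.Sigma) simp_all
    finally show ?thesis .
  qed
qed

text \<open>
  Every covector with nonzero coordinates at which the symbols of the generators vanish belongs to
  the characteristic variety, for any homogeneous matrix of full row rank. The proof fixes an
  operator of the ideal, splits its terms by weight, and compares leading coefficients along the
  lines of direction $(x_v\xi_v)_v$ in the solution spaces of $AM = \beta - \nu$.
\<close>

lemma char_variety_hypergeometric:
  fixes A :: "int ^ 'v::finite ^ 'r::finite"
  assumes nonzero: "\<And>v. \<xi> $ v \<noteq> 0"
    and toric: "\<And>p q. A *v expo_vec p = A *v expo_vec q \<Longrightarrow> mono_eval p \<xi> = mono_eval q \<xi>"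
    and homogeneous: "\<And>p q. A *v expo_vec p = A *v expo_vec q \<Longrightarrow> expo_degree p = expo_degree q"
    and surj: "surj (weight A)"
    and euler: "weight A (\<chi> v. x $ v * \<xi> $ v) = 0"
  shows "(x, \<xi>) \<in> char_variety (hypergeometric_ideal A \<beta>)"
  unfolding char_variety_iff
proof (intro allI impI)
  fix c :: "'v symb"
  assume c: "normal_op c \<in> hypergeometric_ideal A \<beta>"
  define W where "W = (\<chi> v. x $ v * \<xi> $ v)"
  define K where "K = Poly_Mapping.keys c"
  define T where "T = {k \<in> K. expo_degree (snd k) = op_order c}"
  define \<nu> where "\<nu> k = weight A (expo_point (snd k) - expo_point (fst k))" for k :: "'v expo \<times> 'v expo"
  have finK: "finite K" and finT: "finite T" by (simp_all add: K_def T_def)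
  have le: "expo_degree (snd k) \<le> op_order c" if "k \<in> K" for k
    unfolding op_order_def using that by (intro Max_ge) (auto simp: K_def case_prod_unfold)
  have group: "(\<Sum>k\<in>{k \<in> T. \<nu> k = \<nu> l}.
      Poly_Mapping.lookup c k * mono_eval (fst k) x * mono_eval (snd k) \<xi>) = 0" if "l \<in> T" for l
  proof -
    define S where "S = {k \<in> K. \<nu> k = \<nu> l}"
    define n where "n = expo_degree (fst l)"
    have finS: "finite S" using finK by (simp add: S_def)
    \<comment> \<open>Equal weights give $A(\beta + \alpha_l) = A(\beta_l + \alpha)$ with both sides in the semigroup, so
       that the hypotheses on exponents apply.\<close>
    have eqA: "A *v expo_vec (snd k + fst l) = A *v expo_vec (snd l + fst k)" if "k \<in> S" for k
      using that unfolding weight_expo_point_eq_iff[symmetric]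
      by (simp add: S_def \<nu>_def expo_point_add weight_add weight_diff algebra_simps)
    have deg: "expo_degree (snd k) + n = op_order c + expo_degree (fst k)" if "k \<in> S" for k
      using homogeneous[OF eqA[OF that]] \<open>l \<in> T\<close>
      by (simp add: expo_degree_def lookup_add sum.distrib n_def T_def)
    obtain M where M: "weight A M = \<beta> - \<nu> l" using surj by (metis surjD)
    have "\<forall>\<alpha>. \<exists>p. (\<forall>t. poly p t = falling_expo \<alpha> (M + t *s W)) \<and> degree p \<le> expo_degree \<alpha>
        \<and> coeff p (expo_degree \<alpha>) = mono_eval \<alpha> W"
      by (meson falling_expo_line_poly)
    then obtain p where p: "poly (p \<alpha>) t = falling_expo \<alpha> (M + t *s W)"
        and deg_p: "degree (p \<alpha>) \<le> expo_degree \<alpha>"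
        and top_p: "coeff (p \<alpha>) (expo_degree \<alpha>) = mono_eval \<alpha> W" for \<alpha> t
      by metis
    have "poly (\<Sum>k\<in>S. smult (Poly_Mapping.lookup c k) (p (fst k))) t = 0" for t
    proof -
      \<comment> \<open>At a point with \<open>AM = \<beta> - \<nu>\<close> the indicator selects exactly the terms of weight \<open>\<nu>\<close>.\<close>
      have "weight_indicator A \<beta> (M + t *s W - expo_point (fst k) + expo_point (snd k)) = of_bool (\<nu> k = \<nu> l)" for k
      proof -
        have "weight A (M + t *s W - expo_point (fst k) + expo_point (snd k)) = \<beta> - \<nu> l + \<nu> k"
          using euler M by (simp add: \<nu>_def weight_add weight_diff weight_scale W_def)
        then show ?thesis by (simp add: weight_indicator_def)
      qed
      then have "0 = (\<Sum>k\<in>K. Poly_Mapping.lookup c k * falling_expo (fst k) (M + t *s W) * of_bool (\<nu> k = \<nu> l))"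
        using hypergeometric_ideal_annihilates[OF c, of "M + t *s W"]
        by (simp add: coeff_action_def case_prod_unfold K_def)
      also have "\<dots> = (\<Sum>k\<in>S. Poly_Mapping.lookup c k * falling_expo (fst k) (M + t *s W))"
        unfolding S_def by (rule sum.mono_neutral_cong_right) (auto simp: finK)
      finally show ?thesis by (simp add: poly_sum p)
    qed
    then have "(\<Sum>k\<in>S. smult (Poly_Mapping.lookup c k) (p (fst k))) = 0"
      using poly_all_0_iff_0 by blast
    then have "0 = coeff (\<Sum>k\<in>S. smult (Poly_Mapping.lookup c k) (p (fst k))) n" by simp
    also have "\<dots> = (\<Sum>k\<in>S. Poly_Mapping.lookup c k * coeff (p (fst k)) n)"
      by (simp add: coeff_sum)
    \<comment> \<open>Terms of lower order also have lower degree in \<open>\<alpha>\<close>, and do not reach the coefficient \<open>n\<close>.\<close>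
    also have "\<dots> = (\<Sum>k\<in>{k \<in> T. \<nu> k = \<nu> l}. Poly_Mapping.lookup c k * mono_eval (fst k) W)"
    proof (rule sum.mono_neutral_cong_right)
      show "finite S" "{k \<in> T. \<nu> k = \<nu> l} \<subseteq> S" using finS by (auto simp: S_def T_def)
      show "\<forall>k\<in>S - {k \<in> T. \<nu> k = \<nu> l}. Poly_Mapping.lookup c k * coeff (p (fst k)) n = 0"
      proof
        fix k assume k: "k \<in> S - {k \<in> T. \<nu> k = \<nu> l}"
        then have "expo_degree (snd k) < op_order c" using le[of k] by (auto simp: S_def T_def)
        then have "degree (p (fst k)) < n" using deg[of k] k deg_p[of "fst k"] by auto
        then show "Poly_Mapping.lookup c k * coeff (p (fst k)) n = 0" by (simp add: coeff_eq_0)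
      qed
      fix k assume k: "k \<in> {k \<in> T. \<nu> k = \<nu> l}"
      then have "expo_degree (fst k) = n" using deg[of k] by (auto simp: S_def T_def)
      then show "Poly_Mapping.lookup c k * coeff (p (fst k)) n = Poly_Mapping.lookup c k * mono_eval (fst k) W"
        using top_p[of "fst k"] by simp
    qed
    finally have "(\<Sum>k\<in>{k \<in> T. \<nu> k = \<nu> l}. Poly_Mapping.lookup c k * mono_eval (fst k) W) = 0" ..
    \<comment> \<open>Within one weight, $\xi^{\beta-\alpha}$ is a constant, because \<open>\<xi>\<close> satisfies the toric equations.\<close>
    moreover have "Poly_Mapping.lookup c k * mono_eval (fst k) x * mono_eval (snd k) \<xi>
        = mono_eval (snd l) \<xi> / mono_eval (fst l) \<xi> * (Poly_Mapping.lookup c k * mono_eval (fst k) W)"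
      if "k \<in> {k \<in> T. \<nu> k = \<nu> l}" for k
    proof -
      have "k \<in> S" using that by (simp add: S_def T_def)
      have "mono_eval (fst l) \<xi> \<noteq> 0" by (simp add: mono_eval_def nonzero)
      moreover have "mono_eval (snd k) \<xi> * mono_eval (fst l) \<xi> = mono_eval (snd l) \<xi> * mono_eval (fst k) \<xi>"
        using toric[OF eqA[OF \<open>k \<in> S\<close>]] by (simp add: mono_eval_add)
      ultimately have "mono_eval (snd k) \<xi> = mono_eval (snd l) \<xi> / mono_eval (fst l) \<xi> * mono_eval (fst k) \<xi>"
        by (simp add: field_simps)
      moreover have "mono_eval (fst k) W = mono_eval (fst k) x * mono_eval (fst k) \<xi>"
        by (simp add: mono_eval_def W_def power_mult_distrib prod.distrib)
      ultimately show ?thesis by simp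
    qed
    ultimately have "(\<Sum>k\<in>{k \<in> T. \<nu> k = \<nu> l}.
        Poly_Mapping.lookup c k * mono_eval (fst k) x * mono_eval (snd k) \<xi>)
        = mono_eval (snd l) \<xi> / mono_eval (fst l) \<xi> * 0"
      by (metis (no_types, lifting) sum.cong sum_distrib_left)
    then show ?thesis by simp
  qed
  have "symb_eval (principal_symbol c) x \<xi>
      = (\<Sum>k\<in>T. Poly_Mapping.lookup c k * mono_eval (fst k) x * mono_eval (snd k) \<xi>)"
    by (simp add: symb_eval_principal_symbol T_def K_def)
  also have "\<dots> = (\<Sum>w\<in>\<nu> ` T. \<Sum>k\<in>{k \<in> T. \<nu> k = w}.
      Poly_Mapping.lookup c k * mono_eval (fst k) x * mono_eval (snd k) \<xi>)"
    by (rule sum.group[symmetric]) (use finT in auto)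
  also have "\<dots> = 0" using group by (intro sum.neutral) auto
  finally show "symb_eval (principal_symbol c) x \<xi> = 0" .
qed


section \<open>Symbols of the generators\<close>

lemma symb_eval_principal_symbol_leading:
  assumes "d \<noteq> 0"
    and d: "\<And>k. k \<in> Poly_Mapping.keys d \<Longrightarrow> expo_degree (snd k) = n"
    and e: "\<And>k. k \<in> Poly_Mapping.keys e \<Longrightarrow> expo_degree (snd k) < n"
  shows "d + e \<noteq> 0" and "symb_eval (principal_symbol (d + e)) x \<xi> = symb_eval d x \<xi>"
proof -
  have disj: "k \<notin> Poly_Mapping.keys e" if "k \<in> Poly_Mapping.keys d" for k using d e that by fastforce
  have keys: "Poly_Mapping.keys (d + e) = Poly_Mapping.keys d \<union> Poly_Mapping.keys e"
  proof (rule set_eqI)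
    fix k show "k \<in> Poly_Mapping.keys (d + e) \<longleftrightarrow> k \<in> Poly_Mapping.keys d \<union> Poly_Mapping.keys e"
      using disj[of k] by (cases "k \<in> Poly_Mapping.keys d") (simp_all add: in_keys_iff lookup_add)
  qed
  obtain k where k: "k \<in> Poly_Mapping.keys d" using \<open>d \<noteq> 0\<close> by (metis keys_eq_empty all_not_in_conv)
  show "d + e \<noteq> 0" using keys k by auto
  have "op_order (d + e) = n"
    unfolding op_order_def
  proof (rule Max_eqI)
    fix m assume "m \<in> (\<lambda>(\<alpha>, \<beta>). expo_degree \<beta>) ` Poly_Mapping.keys (d + e)"
    then obtain l where l: "l \<in> Poly_Mapping.keys (d + e)" "m = expo_degree (snd l)"
      by (auto simp: case_prod_unfold)
    then show "m \<le> n" using d[of l] e[of l] unfolding keys by fastforce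
  next
    show "n \<in> (\<lambda>(\<alpha>, \<beta>). expo_degree \<beta>) ` Poly_Mapping.keys (d + e)"
      using d[OF k] k by (auto simp: keys case_prod_unfold intro!: rev_image_eqI[of k])
  qed simp
  moreover have "{k \<in> Poly_Mapping.keys (d + e). expo_degree (snd k) = n} = Poly_Mapping.keys d"
    using d e unfolding keys by fastforce
  ultimately have "symb_eval (principal_symbol (d + e)) x \<xi> = (\<Sum>k\<in>Poly_Mapping.keys d.
      Poly_Mapping.lookup (d + e) k * mono_eval (fst k) x * mono_eval (snd k) \<xi>)"
    by (simp add: symb_eval_principal_symbol)
  also have "\<dots> = (\<Sum>k\<in>Poly_Mapping.keys d.
      Poly_Mapping.lookup d k * mono_eval (fst k) x * mono_eval (snd k) \<xi>)"
    using disj by (intro sum.cong) (auto simp: lookup_add in_keys_iff)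
  finally show "symb_eval (principal_symbol (d + e)) x \<xi> = symb_eval d x \<xi>"
    by (simp add: symb_eval_def case_prod_unfold)
qed

lemma const_coeff_symb_add: "const_coeff_symb (p + q) = const_coeff_symb p + const_coeff_symb q"
  unfolding const_coeff_symb_def by (rule setsum_keys_plus_distrib) (simp_all add: single_add)

lemma const_coeff_symb_single:
  "const_coeff_symb (Poly_Mapping.single \<beta> a) = Poly_Mapping.single (0, \<beta>) a"
  by (simp add: const_coeff_symb_def)

lemma char_variety_hypergeometric_toric:
  fixes A :: "int ^ 'v::finite ^ 'r::finite"
  assumes "(x, \<xi>) \<in> char_variety (hypergeometric_ideal A \<beta>)"
    and "A *v expo_vec p = A *v expo_vec q" and "expo_degree p = expo_degree q"
  shows "mono_eval p \<xi> = mono_eval q \<xi>"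
proof (cases "p = q")
  case False
  define b :: "'v mpoly" where "b = Poly_Mapping.single p 1 - Poly_Mapping.single q 1"
  define d :: "'v symb" where "d = Poly_Mapping.single (0, p) 1 + Poly_Mapping.single (0, q) (- 1)"
  have "b = Poly_Mapping.single p 1 + Poly_Mapping.single q (- 1)"
    by (simp add: b_def single_uminus)
  then have op: "const_coeff_op b = normal_op d"
    by (simp only: normal_op_const_coeff_symb[symmetric] const_coeff_symb_add const_coeff_symb_single d_def)
  have "b \<in> toric_ideal A"
    unfolding toric_ideal_def ideal_gen_def b_def
    by (rule module.span_base[OF module_times]) (use assms(2) in blast)
  then have "normal_op d \<in> hypergeometric_ideal A \<beta>"
    unfolding hypergeometric_ideal_def op[symmetric] by (intro left_ideal.gen) blast
  moreover have "Poly_Mapping.lookup d (0, p) = 1"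
    using False by (simp add: d_def lookup_add lookup_single when_def)
  then have "d \<noteq> 0" by (metis lookup_zero zero_neq_one)
  moreover have "k = (0, p) \<or> k = (0, q)" if "k \<in> Poly_Mapping.keys d" for k
    using that by (auto simp: d_def in_keys_iff lookup_add lookup_single when_def split: if_splits)
  then have "expo_degree (snd k) = expo_degree p" if "k \<in> Poly_Mapping.keys d" for k
    using that assms(3) by (metis snd_conv)
  ultimately have "symb_eval d x \<xi> = 0"
    using assms(1) symb_eval_principal_symbol_leading(2)[of d "expo_degree p" 0 x \<xi>]
    by (simp add: char_variety_iff)
  then show ?thesis by (simp add: d_def symb_eval_add symb_eval_single)
qed simp

lemma char_variety_hypergeometric_euler:
  fixes A :: "int ^ 'v::finite ^ 'r::finite"
  assumes "(x, \<xi>) \<in> char_variety (hypergeometric_ideal A \<beta>)"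
  shows "weight A (\<chi> v. x $ v * \<xi> $ v) = 0"
proof -
  have "weight A (\<chi> v. x $ v * \<xi> $ v) $ i = 0" for i
  proof (cases "\<forall>v. A $ i $ v = 0")
    case True
    then show ?thesis by (simp add: weight_def)
  next
    case False
    then obtain w where w: "A $ i $ w \<noteq> 0" by blast
    define E :: "'v \<Rightarrow> 'v expo \<times> 'v expo" where
      "E v = (Poly_Mapping.single v 1, Poly_Mapping.single v 1)" for v
    define d where "d = (\<Sum>v\<in>UNIV. Poly_Mapping.single (E v) (of_int (A $ i $ v) :: complex))"
    have E_inj: "E v = E u \<longleftrightarrow> v = u" for u v
    proof
      assume "E v = E u"
      then have "Poly_Mapping.lookup (fst (E v)) v = Poly_Mapping.lookup (fst (E u)) v" by simp
      then show "v = u" by (simp add: E_def lookup_single when_def split: if_splits)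
    qed simp
    have "Poly_Mapping.lookup d (E w) = of_int (A $ i $ w)"
      by (simp add: d_def lookup_sum lookup_single when_def E_inj)
    with w have "d \<noteq> 0" by auto
    moreover have "expo_degree (snd k) = 1" if "k \<in> Poly_Mapping.keys d" for k
    proof -
      have "k \<in> (\<Union>v. Poly_Mapping.keys (Poly_Mapping.single (E v) (of_int (A $ i $ v) :: complex)))"
        using that keys_sum[of "\<lambda>v. Poly_Mapping.single (E v) (of_int (A $ i $ v) :: complex)" UNIV]
        unfolding d_def by blast
      then obtain v where "snd k = Poly_Mapping.single v 1" by (auto simp: E_def split: if_splits)
      then show ?thesis by (simp add: expo_degree_def lookup_single when_def)
    qed
    moreover have "expo_degree (snd k) < 1" if "k \<in> Poly_Mapping.keys (Poly_Mapping.single (0, 0) (- \<beta> $ i))" for k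
      using that by (auto simp: expo_degree_def split: if_splits)
    ultimately have "euler_symb A \<beta> i \<noteq> 0"
        "symb_eval (principal_symbol (euler_symb A \<beta> i)) x \<xi> = symb_eval d x \<xi>"
      using symb_eval_principal_symbol_leading(1)[of d 1 "Poly_Mapping.single (0, 0) (- \<beta> $ i)"]
        symb_eval_principal_symbol_leading(2)[of d 1 "Poly_Mapping.single (0, 0) (- \<beta> $ i)" x \<xi>]
      unfolding euler_symb_def E_def[symmetric] d_def[symmetric] by blast+
    moreover have "normal_op (euler_symb A \<beta> i) \<in> hypergeometric_ideal A \<beta>"
      unfolding hypergeometric_ideal_def normal_op_euler_symb by (intro left_ideal.gen) blast
    ultimately have "symb_eval d x \<xi> = 0"
      using assms by (auto simp: char_variety_iff)
    then show ?thesis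
      by (simp add: d_def E_def weight_def symb_eval_sum symb_eval_single mono_eval_single mult.assoc)
  qed
  then show ?thesis by (simp add: vec_eq_iff)
qed

section \<open>The matrix of Lauricella's system\<close>

lemma sum_UNIV_Plus:
  fixes f :: "'a::finite + 'b::finite \<Rightarrow> 'c::comm_monoid_add"
  shows "(\<Sum>v\<in>UNIV. f v) = (\<Sum>k\<in>UNIV. f (Inl k)) + (\<Sum>k\<in>UNIV. f (Inr k))"
  unfolding UNIV_Plus_UNIV[symmetric] by (subst sum.Plus) simp_all

lemma prod_UNIV_Plus:
  fixes f :: "'a::finite + 'b::finite \<Rightarrow> 'c::comm_monoid_mult"
  shows "(\<Prod>v\<in>UNIV. f v) = (\<Prod>k\<in>UNIV. f (Inl k)) * (\<Prod>k\<in>UNIV. f (Inr k))"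
  unfolding UNIV_Plus_UNIV[symmetric] by (subst prod.Plus) simp_all

lemma sum_UNIV_option:
  fixes f :: "'a::finite option \<Rightarrow> 'c::comm_monoid_add"
  shows "(\<Sum>k\<in>UNIV. f k) = f None + (\<Sum>j\<in>UNIV. f (Some j))"
  by (simp add: UNIV_option_conv sum.reindex)

lemma FC_matrix_simps:
  "FC_matrix $ None $ v = 1"
  "FC_matrix $ Some k $ Inl l = (if l = k then 1 else 0)"
  "FC_matrix $ Some k $ Inr l = (if l = k then - 1 else 0)"
  by (auto simp: FC_matrix_def FC_column_def axis_def split: sum.splits)

lemma weight_FC_matrix:
  "weight FC_matrix M $ None = (\<Sum>k\<in>UNIV. M $ Inl k + M $ Inr k)"
  "weight FC_matrix M $ Some k = M $ Inl k - M $ Inr k"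
proof -
  have "of_int (if l = k then z else 0) * y = (if l = k then of_int z * y else 0)" for l z and y :: complex
    by simp
  then show "weight FC_matrix M $ Some k = M $ Inl k - M $ Inr k"
    by (simp add: weight_def sum_UNIV_Plus FC_matrix_simps)
qed (simp add: weight_def sum_UNIV_Plus FC_matrix_simps sum.distrib)

lemma FC_matrix_expo_vec_eq_iff:
  "FC_matrix *v expo_vec p = FC_matrix *v expo_vec q \<longleftrightarrow> expo_degree p = expo_degree q \<and>
     (\<forall>k. Poly_Mapping.lookup p (Inl k) + Poly_Mapping.lookup q (Inr k)
        = Poly_Mapping.lookup q (Inl k) + Poly_Mapping.lookup p (Inr k))"
proof -
  have 1: "(FC_matrix *v expo_vec r) $ None = int (expo_degree r)" for r :: "'a fc_var expo"
    by (simp add: matrix_vector_mult_def FC_matrix_simps expo_vec_def expo_degree_def)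
  have "(if l = k then z else 0) * y = (if l = k then z * y else 0)" for k l :: "'a option" and z y :: int
    by simp
  then have 2: "(FC_matrix *v expo_vec r) $ Some k
      = int (Poly_Mapping.lookup r (Inl k)) - int (Poly_Mapping.lookup r (Inr k))" for r :: "'a fc_var expo" and k
    by (simp add: matrix_vector_mult_def FC_matrix_simps expo_vec_def sum_UNIV_Plus)
  have "FC_matrix *v expo_vec p = FC_matrix *v expo_vec q \<longleftrightarrow>
      (FC_matrix *v expo_vec p) $ None = (FC_matrix *v expo_vec q) $ None \<and>
      (\<forall>k. (FC_matrix *v expo_vec p) $ Some k = (FC_matrix *v expo_vec q) $ Some k)"
    unfolding vec_eq_iff using option.exhaust by metis
  then show ?thesis unfolding 1 2 by (simp add: algebra_simps flip: of_nat_add)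
qed

lemma surj_weight_FC_matrix: "surj (weight (FC_matrix :: int ^ 'm::finite fc_var ^ 'm fc_row))"
unfolding surj_def
proof
  fix z :: "complex ^ 'm fc_row"
  define s where "s = z $ None - (\<Sum>j\<in>UNIV. z $ Some (Some j))"
  \<comment> \<open>The two coordinates of the last pair have prescribed difference; their sum \<open>s\<close> is what the last
     row still requires.\<close>
  define M :: "complex ^ 'm fc_var" where
    "M = (\<chi> v. case v of
        Inl None \<Rightarrow> (s + z $ Some None) / 2 | Inr None \<Rightarrow> (s - z $ Some None) / 2
      | Inl (Some j) \<Rightarrow> z $ Some (Some j) | Inr (Some j) \<Rightarrow> 0)"
  have "weight FC_matrix M $ i = z $ i" for i
  proof (cases i)
    case None
    have "(s + z $ Some None) / 2 + (s - z $ Some None) / 2 = s" by (simp add: field_simps)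
    with None show ?thesis
      by (simp add: weight_FC_matrix sum_UNIV_option M_def) (simp add: s_def)
  next
    case (Some k)
    then show ?thesis
      by (cases k) (simp_all add: weight_FC_matrix M_def field_simps)
  qed
  then have "z = weight FC_matrix M" by (simp add: vec_eq_iff)
  then show "\<exists>M. z = weight FC_matrix M" ..
qed

lemma singular_locus_iff:
  "x \<in> singular_locus I \<longleftrightarrow> (\<exists>\<xi>. (x, \<xi>) \<in> char_variety I \<and> \<xi> \<noteq> 0)"
  unfolding singular_locus_def image_iff by force

text \<open>
  The coordinate of \<open>w\<close> at \<open>None\<close> cannot vanish, since it would make the common value \<open>t\<close> of all
  $\xi_k\xi_{-k}$ zero, then all $w_k$, and finally \<open>\<xi>\<close>. Division by it turns $\sum_k w_k = 0$ into the relation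
  between square roots.
\<close>

lemma FC_singular_imp_sqrt_relation:
  fixes u \<xi> :: "complex ^ 'm::finite fc_var"
  assumes ch: "(u, \<xi>) \<in> char_variety (hypergeometric_ideal FC_matrix \<beta>)"
    and "\<xi> \<noteq> 0" and "u \<in> torus"
  shows "\<exists>\<epsilon>. (\<forall>j. \<epsilon> j \<in> {- 1, 1}) \<and> 1 + (\<Sum>j\<in>UNIV. \<epsilon> j * csqrt (FC_ratio u j)) = 0"
proof -
  have u: "u $ v \<noteq> 0" for v using \<open>u \<in> torus\<close> by (simp add: torus_def)
  define w where "w k = u $ Inl k * \<xi> $ Inl k" for k
  define t where "t = \<xi> $ Inl None * \<xi> $ Inr None"
  have euler: "weight FC_matrix (\<chi> v. u $ v * \<xi> $ v) $ i = 0" for i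
    using char_variety_hypergeometric_euler[OF ch] by simp
  have w': "w k = u $ Inr k * \<xi> $ Inr k" for k
    using euler[of "Some k"] by (simp add: weight_FC_matrix w_def)
  have "(\<Sum>k\<in>UNIV. w k + w k) = 0"
    using euler[of None] unfolding weight_FC_matrix by (simp add: w'[symmetric]) (simp add: w_def mult.commute)
  then have "(\<Sum>k\<in>UNIV. w k) = 0"
    unfolding sum.distrib by simp
  then have sum_w: "w None + (\<Sum>j\<in>UNIV. w (Some j)) = 0"
    unfolding sum_UNIV_option .
  have t: "\<xi> $ Inl k * \<xi> $ Inr k = t" for k
  proof -
    let ?p = "\<lambda>k. Poly_Mapping.single (Inl k) 1 + Poly_Mapping.single (Inr k) 1 :: 'm fc_var expo"
    have deg: "expo_degree (?p k) = 2" for k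
      by (simp add: expo_degree_def sum_UNIV_Plus lookup_add lookup_single when_def)
    have "mono_eval (?p k) \<xi> = mono_eval (?p None) \<xi>"
      using deg
      by (intro char_variety_hypergeometric_toric[OF ch])
        (auto simp: FC_matrix_expo_vec_eq_iff lookup_add lookup_single when_def)
    then show ?thesis by (simp add: mono_eval_add mono_eval_single t_def)
  qed
  have w2: "(w k)\<^sup>2 = u $ Inl k * u $ Inr k * t" for k
  proof -
    have "(w k)\<^sup>2 = (u $ Inl k * \<xi> $ Inl k) * (u $ Inr k * \<xi> $ Inr k)"
      by (simp only: power2_eq_square w'[symmetric]) (simp add: w_def)
    also have "\<dots> = u $ Inl k * u $ Inr k * (\<xi> $ Inl k * \<xi> $ Inr k)"
      by (simp only: ac_simps)
    finally show ?thesis by (simp only: t)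
  qed
  have "w None \<noteq> 0"
  proof
    assume "w None = 0"
    then have "t = 0" using w2[of None] u by simp
    then have "w k = 0" for k using w2[of k] by simp
    then have "\<xi> $ v = 0" for v
      using w_def w' u by (cases v) (metis mult_eq_0_iff)+
    with \<open>\<xi> \<noteq> 0\<close> show False by (simp add: vec_eq_iff)
  qed
  then have "t \<noteq> 0" using w2[of None] by auto
  have "(w (Some j) / w None)\<^sup>2 = (csqrt (FC_ratio u j))\<^sup>2" for j
    using \<open>t \<noteq> 0\<close> by (simp add: power_divide w2 FC_ratio_def)
  then have "\<exists>e. e \<in> {- 1, 1} \<and> w (Some j) / w None = e * csqrt (FC_ratio u j)" for j
    by (metis insertCI mult_1 mult_minus1 power2_eq_iff)
  then obtain \<epsilon> where \<epsilon>: "\<And>j. \<epsilon> j \<in> {- 1, 1}"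
    "\<And>j. w (Some j) / w None = \<epsilon> j * csqrt (FC_ratio u j)" by metis
  have "1 + (\<Sum>j\<in>UNIV. \<epsilon> j * csqrt (FC_ratio u j)) = (w None + (\<Sum>j\<in>UNIV. w (Some j))) / w None"
    using \<open>w None \<noteq> 0\<close> by (simp add: \<epsilon>(2)[symmetric] sum_divide_distrib add_divide_distrib)
  then have "1 + (\<Sum>j\<in>UNIV. \<epsilon> j * csqrt (FC_ratio u j)) = 0" using sum_w by simp
  with \<epsilon>(1) show ?thesis by (intro exI[of _ \<epsilon>] conjI allI)
qed

lemma power_mult_inverse_pair_eq:
  fixes x y :: "'a::comm_monoid_mult"
  assumes "x * y = 1" and "a + d = c + b"
  shows "x ^ a * y ^ b = x ^ c * y ^ d"
proof -
  have *: "x ^ (c + n) * y ^ (d + n) = x ^ c * y ^ d" for c d n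
  proof -
    have "x ^ (c + n) * y ^ (d + n) = x ^ c * y ^ d * (x * y) ^ n"
      by (simp add: power_add power_mult_distrib ac_simps)
    then show ?thesis using assms(1) by simp
  qed
  show ?thesis
  proof (cases "c \<le> a")
    case True
    then obtain n where "a = c + n" by (auto simp: le_iff_add)
    with assms(2) have "b = d + n" by simp
    with \<open>a = c + n\<close> * [of c n d] show ?thesis by simp
  next
    case False
    then obtain n where "c = a + n" by (metis le_iff_add nat_le_linear)
    with assms(2) have "d = b + n" by simp
    with \<open>c = a + n\<close> * [of a n b] show ?thesis by simp
  qed
qed

text \<open>
  The covector is $\xi_{\pm k} = w_k/u_{\pm k}$, where \<open>w\<close> is recovered up to scaling from the terms
  of the vanishing factor.
\<close>

lemma FC_sqrt_relation_imp_singular: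
  fixes u :: "complex ^ 'm::finite fc_var"
  assumes "u \<in> torus" and \<epsilon>: "\<And>j. \<epsilon> j \<in> {- 1, 1}"
    and rel: "1 + (\<Sum>j\<in>UNIV. \<epsilon> j * csqrt (FC_ratio u j)) = 0"
  shows "u \<in> singular_locus (hypergeometric_ideal FC_matrix \<beta>)"
proof -
  have u: "u $ v \<noteq> 0" for v using \<open>u \<in> torus\<close> by (simp add: torus_def)
  define s where "s = csqrt (u $ Inl None * u $ Inr None)"
  \<comment> \<open>Normalising the last entry so that $w_k^2 = u_ku_{-k}$ gives $\xi_k\xi_{-k} = 1$ for all \<open>k\<close>,
     whence $\xi^p$ depends on $Ap$ only.\<close>
  define w where "w k = (case k of None \<Rightarrow> s | Some j \<Rightarrow> \<epsilon> j * csqrt (FC_ratio u j) * s)" for k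
  define \<xi> :: "complex ^ 'm fc_var" where
    "\<xi> = (\<chi> v. w (case v of Inl k \<Rightarrow> k | Inr k \<Rightarrow> k) / u $ v)"
  have w2: "(w k)\<^sup>2 = u $ Inl k * u $ Inr k" for k
  proof (cases k)
    case (Some j)
    have "(\<epsilon> j)\<^sup>2 = 1" using \<epsilon>[of j] by auto
    then show ?thesis
      using u by (simp add: w_def s_def Some power_mult_distrib FC_ratio_def)
  qed (simp add: w_def s_def)
  then have w: "w k \<noteq> 0" for k
    using u by (metis mult_eq_0_iff zero_power2)
  have pair: "\<xi> $ Inl k * \<xi> $ Inr k = 1" for k
    using w2[of k] u by (simp add: \<xi>_def power2_eq_square)
  have sum_w: "(\<Sum>k\<in>UNIV. w k) = 0"
  proof -
    have "(\<Sum>k\<in>UNIV. w k) = (1 + (\<Sum>j\<in>UNIV. \<epsilon> j * csqrt (FC_ratio u j))) * s"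
      by (simp add: sum_UNIV_option w_def sum_distrib_right distrib_right)
    then show ?thesis using rel by simp
  qed
  have "(u, \<xi>) \<in> char_variety (hypergeometric_ideal FC_matrix \<beta>)"
  proof (rule char_variety_hypergeometric[OF _ _ _ surj_weight_FC_matrix])
    show "\<xi> $ v \<noteq> 0" for v using u w by (simp add: \<xi>_def)
    show "weight FC_matrix (\<chi> v. u $ v * \<xi> $ v) = 0"
    proof -
      have "weight FC_matrix (\<chi> v. u $ v * \<xi> $ v) $ i = 0" for i
      proof (cases i)
        case None
        have "(\<Sum>k\<in>UNIV. w k + w k) = 0" using sum_w by (simp only: sum.distrib) simp
        with None u show ?thesis by (simp add: weight_FC_matrix \<xi>_def)
      qed (use u in \<open>simp add: weight_FC_matrix \<xi>_def\<close>)
      then show ?thesis by (simp add: vec_eq_iff)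
    qed
    fix p q :: "'m fc_var expo"
    assume "FC_matrix *v expo_vec p = FC_matrix *v expo_vec q"
    then have pq: "expo_degree p = expo_degree q"
      "Poly_Mapping.lookup p (Inl k) + Poly_Mapping.lookup q (Inr k)
        = Poly_Mapping.lookup q (Inl k) + Poly_Mapping.lookup p (Inr k)" for k
      by (auto simp: FC_matrix_expo_vec_eq_iff)
    show "expo_degree p = expo_degree q" by fact
    show "mono_eval p \<xi> = mono_eval q \<xi>"
      unfolding mono_eval_def prod_UNIV_Plus prod.distrib[symmetric]
      by (intro prod.cong refl power_mult_inverse_pair_eq[OF pair pq(2)])
  qed
  moreover have "\<xi> \<noteq> 0" using pair by (metis mult_zero_left zero_index zero_neq_one)
  ultimately show ?thesis by (auto simp: singular_locus_iff)
qed

theorem theorem5p3: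
  fixes a b :: complex and c :: "complex ^ 'm::finite"
  shows "singular_locus (hypergeometric_ideal FC_matrix (FC_beta a b c)) \<inter> torus =
    {u \<in> torus. (\<Prod>\<epsilon>\<in>{\<epsilon> :: 'm \<Rightarrow> complex. \<forall>j. \<epsilon> j \<in> {-1, 1}}.
        1 + (\<Sum>j\<in>UNIV. \<epsilon> j * csqrt (FC_ratio u j))) = 0}"
proof -
  let ?I = "hypergeometric_ideal FC_matrix (FC_beta a b c)"
  let ?signs = "{\<epsilon> :: 'm \<Rightarrow> complex. \<forall>j. \<epsilon> j \<in> {-1, 1}}"
  have fin: "finite ?signs"
    using finite_set_of_finite_funs[of "UNIV :: 'm set" "{- 1, 1 :: complex}" undefined] by simp
  have "u \<in> singular_locus ?I \<longleftrightarrow>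
      (\<exists>\<epsilon>\<in>?signs. 1 + (\<Sum>j\<in>UNIV. \<epsilon> j * csqrt (FC_ratio u j)) = 0)" if u: "u \<in> torus" for u
  proof
    assume "u \<in> singular_locus ?I"
    then obtain \<xi> where \<xi>: "(u, \<xi>) \<in> char_variety ?I" "\<xi> \<noteq> 0"
      unfolding singular_locus_iff by blast
    from FC_singular_imp_sqrt_relation[OF \<xi> u]
    show "\<exists>\<epsilon>\<in>?signs. 1 + (\<Sum>j\<in>UNIV. \<epsilon> j * csqrt (FC_ratio u j)) = 0"
      unfolding Bex_def mem_Collect_eq .
  next
    assume "\<exists>\<epsilon>\<in>?signs. 1 + (\<Sum>j\<in>UNIV. \<epsilon> j * csqrt (FC_ratio u j)) = 0"
    then obtain \<epsilon> where \<epsilon>: "\<epsilon> \<in> ?signs" "1 + (\<Sum>j\<in>UNIV. \<epsilon> j * csqrt (FC_ratio u j)) = 0"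
      by (rule bexE)
    from \<epsilon>(1) have "\<epsilon> j \<in> {- 1, 1}" for j by simp
    from FC_sqrt_relation_imp_singular[OF u this \<epsilon>(2)] show "u \<in> singular_locus ?I" .
  qed
  then show ?thesis unfolding prod_zero_iff[OF fin] by blast
qed

end
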